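(* Let $G$ be the group of similarities of $\mathbb{R}^d$ and let $(C_1,\dots,C_N,Q)$ be a random element of $G^N\times\mathbb{R}^d$. Assume that one of the two cases (H) or (I) described in the context holds, and let $R$ be the unique solution of $R\stackrel{d}{=}\sum_{i=1}^N C_iR_i+Q$ specified there. Assume the existence of $\alpha<\beta<s_\infty$ with $m(\alpha)=m(\beta)=1$, that $\mathbb{E}|Q|^{\beta}<\infty$, that $\log\|C_i\|$, $i=1,\dots,N$, are nonarithmetic, and additionally that $\mathbb{E}|Q|^{s_\infty}<\infty$. Let $K_+=\lim_{t\to\infty}t^\beta\,\mathbb{P}(|R|>t)$ and let $\sigma$ be the finite measure on the unit sphere $S$ described in the context. Then either $K_+$ and $\sigma(S)$ are positive, or $\mathbb{E}|R|^s<\infty$ for all $s<s_\infty$.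
   Context: Let $d\ge1$, $N\ge2$ be integers; $|\cdot|$ is the Euclidean norm, $S$ the unit sphere of $\mathbb{R}^d$, $\|\cdot\|$ the operator norm. The group of similarities is $G=\{g\in GL(d,\mathbb{R}):|gx|=\|g\||x|\ \forall x\in\mathbb{R}^d\}$, the direct product of the multiplicative group $\mathbb{R}^+=(0,\infty)$ and $O(d)$. A probability measure on $\mathbb{R}$ is nonarithmetic if the smallest closed subgroup of $\mathbb{R}$ containing its support is $\mathbb{R}$; a random variable is nonarithmetic if its law is. Let $I$ be uniform on $\{1,\dots,N\}$, independent of $(C_1,\dots,C_N,Q)$, and $C:=C_I$. Let $\mu$ be the law of $C$ and $G_\mu$ the subgroup of $G$ generated by the support of $\mu$. Set $s_\infty:=\sup\{s>0:\mathbb{E}\|C\|^s<\infty\}$, $m(s):=N\,\mathbb{E}\|C\|^s$ for $0<s<s_\infty$, $\alpha:=\inf\{s>0:m(s)\le1\}$, $\beta:=\sup\{s>0:m(s)\le 1\}$. If $s_\infty=\infty$, $\mathbb{E}|Q|^{s_\infty}<\infty$ is read as finiteness of all moments of $|Q|$. A random vector $R$ is a solution of $R\stackrel{d}{=}\sum_{i=1}^N C_iR_i+Q$ if the equality in law holds with $R,R_1,\dots,R_N$ iid and independent of $(C_1,\dots,C_N,Q)$. Case (H): $Q=0$, $\alpha\le 2$, $r\in\mathbb{R}^d$ satisfies $r=N\,\mathbb{E}[C]\,r$, and, if $\alpha=2$, $\Sigma$ is a symmetric positive definite matrix with $\Sigma=N\,\mathbb{E}[C\Sigma C^\top]$. Then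 $R$ denotes the unique (in law) solution with $\mathbb{E}R=r$, $\mathbb{E}|R|^s<\infty$ for all $s<\beta$ and, if $\alpha=2$, covariance matrix $\Sigma$. Case (I): $0<\alpha<2$; if $\alpha\ge1$, $r\in\mathbb{R}^d$ satisfies $r=N\,\mathbb{E}[C]\,r+\mathbb{E}Q$; and $\mathbb{E}|Q|^s<\infty$ for some $s$ with $\alpha<s<\min\{s_\infty,2\}$. Then $R$ denotes the unique (in law) solution with $\mathbb{E}R=r$; it satisfies $\mathbb{E}|R|^s<\infty$ for all $s<\beta$. (For $\alpha<1$ no vector $r$ is introduced; there $R$ is the unique solution with $\mathbb{E}|R|^s<\infty$ for all $s<\beta$.) It is part of the setting (a preceding theorem) that under the assumptions made on $(C_1,\dots,C_N,Q)$ the limit $K_+=\lim_{t\to\infty}t^\beta\,\mathbb{P}(|R|>t)$ exists, and that there is a unique Radon measure $\Lambda$ on $\mathbb{R}^d\setminus\{0\}$ with $\lim_{\|a\|\to0,\,a\in G_\mu}\|a\|^{-\beta}\mathbb{E}f(aR)=\int f\,d\Lambda$ for all continuous compactly supported $f$ on $\mathbb{R}^d\setminus\{0\}$, which has the form $\int f\,d\Lambda=\int_0^\infty\int_S f(tw)\,\sigma(dw)\,t^{-1-\beta}dt$ for a finite measure $\sigma$ on $S$. *)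

theory Defs
  imports
    "HOL-Probability.Probability"
    "HOL-Algebra.Generated_Groups"
    "HOL-Library.Going_To_Filter"
begin

text \<open>Throughout, \<open>\<real>\<^sup>d\<close> is the type \<open>real ^ 'n\<close> with \<open>d = CARD('n)\<close>.\<close>

abbreviation opnorm :: "real ^ 'n ^ 'm \<Rightarrow> real" where
  "opnorm A \<equiv> onorm ((*v) A)"

definition similarities :: "(real ^ 'n ^ 'n) set" where
  "similarities = {g. invertible g \<and> (\<forall>x. norm (g *v x) = opnorm g * norm x)}"

definition similarity_group :: "(real ^ 'n ^ 'n) monoid" where
  "similarity_group = \<lparr>carrier = similarities, mult = (**), one = mat 1\<rparr>"

definition pos_def_matrix :: "real ^ 'n ^ 'n \<Rightarrow> bool" where
  "pos_def_matrix S \<longleftrightarrow> transpose S = S \<and> (\<forall>x. x \<noteq> 0 \<longrightarrow> x \<bullet> (S *v x) > 0)"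

definition outer :: "real ^ 'n \<Rightarrow> real ^ 'm \<Rightarrow> real ^ 'm ^ 'n" where
  "outer x y = (\<chi> i j. x $ i * y $ j)"


definition msupport :: "'a::topological_space measure \<Rightarrow> 'a set" where
  "msupport \<nu> = {x. \<forall>U. open U \<and> x \<in> U \<longrightarrow> emeasure \<nu> U > 0}"

definition real_add_group :: "real monoid" where
  "real_add_group = \<lparr>carrier = UNIV, mult = (+), one = 0\<rparr>"

definition nonarithmetic :: "real measure \<Rightarrow> bool" where
  "nonarithmetic \<nu> \<longleftrightarrow>
     \<Inter>{H. subgroup H real_add_group \<and> closed H \<and> msupport \<nu> \<subseteq> H} = UNIV"

text \<open>\<open>moment M Y s\<close> is \<open>E[Y\<^sup>s]\<close> for nonnegative \<open>Y\<close> and \<open>s > 0\<close>, with value \<open>\<infinity>\<close> allowed.\<close>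

definition moment :: "'a measure \<Rightarrow> ('a \<Rightarrow> real) \<Rightarrow> real \<Rightarrow> ennreal" where
  "moment M Y s = (\<integral>\<^sup>+\<omega>. ennreal (Y \<omega> powr s) \<partial>M)"

text \<open>Finiteness of the moment of order \<open>s\<close>, \<open>0 < s \<le> \<infinity>\<close>; for \<open>s = \<infinity>\<close> this means that all moments
  are finite.\<close>

definition finite_moment_ereal :: "'a measure \<Rightarrow> ('a \<Rightarrow> real) \<Rightarrow> ereal \<Rightarrow> bool" where
  "finite_moment_ereal M Y s \<longleftrightarrow>
     (if s = \<infinity> then \<forall>p>0. moment M Y p < \<infinity> else moment M Y (real_of_ereal s) < \<infinity>)"


text \<open>The law \<open>\<mu>\<close> of \<open>C\<^sub>I\<close>. The index \<open>I\<close> is the first coordinate on the product of the uniform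
  distribution on \<open>{1..N}\<close> with the underlying space, so it is uniform and independent of
  \<open>(C\<^sub>1, \<dots>, C\<^sub>N, Q)\<close>.\<close>

definition law_C :: "'a measure \<Rightarrow> nat \<Rightarrow> (nat \<Rightarrow> 'a \<Rightarrow> real ^ 'n ^ 'n) \<Rightarrow> (real ^ 'n ^ 'n) measure" where
  "law_C M N C = distr (uniform_count_measure {1..N} \<Otimes>\<^sub>M M) borel (\<lambda>(i, \<omega>). C i \<omega>)"

text \<open>The intersection with the similarities makes this the support within the topological space
  of similarities: the support within the space of all matrices may contain the zero matrix.\<close>

definition G_gen :: "(real ^ 'n ^ 'n) measure \<Rightarrow> (real ^ 'n ^ 'n) set" where
  "G_gen \<mu> = generate similarity_group (msupport \<mu> \<inter> similarities)"

definition s_infty :: "(real ^ 'n ^ 'n) measure \<Rightarrow> ereal" where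
  "s_infty \<mu> = Sup {ereal s | s. s > 0 \<and> moment \<mu> opnorm s < \<infinity>}"

definition m_fun :: "nat \<Rightarrow> (real ^ 'n ^ 'n) measure \<Rightarrow> real \<Rightarrow> ennreal" where
  "m_fun N \<mu> s = of_nat N * moment \<mu> opnorm s"

definition alpha_exp :: "nat \<Rightarrow> (real ^ 'n ^ 'n) measure \<Rightarrow> ereal" where
  "alpha_exp N \<mu> = Inf {ereal s | s. s > 0 \<and> ereal s < s_infty \<mu> \<and> m_fun N \<mu> s \<le> 1}"

definition beta_exp :: "nat \<Rightarrow> (real ^ 'n ^ 'n) measure \<Rightarrow> ereal" where
  "beta_exp N \<mu> = Sup {ereal s | s. s > 0 \<and> ereal s < s_infty \<mu> \<and> m_fun N \<mu> s \<le> 1}"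


text \<open>The law of \<open>C\<^sub>1 R\<^sub>1 + \<dots> + C\<^sub>N R\<^sub>N + Q\<close>, where the \<open>R\<^sub>i\<close> are the coordinates on a product space,
  hence iid with law \<open>\<rho>\<close> and independent of \<open>(C\<^sub>1, \<dots>, C\<^sub>N, Q)\<close>.\<close>

definition smoothing_transform ::
  "'a measure \<Rightarrow> nat \<Rightarrow> (nat \<Rightarrow> 'a \<Rightarrow> real ^ 'n ^ 'n) \<Rightarrow> ('a \<Rightarrow> real ^ 'n) \<Rightarrow>
   (real ^ 'n) measure \<Rightarrow> (real ^ 'n) measure" where
  "smoothing_transform M N C Q \<rho> =
     distr (M \<Otimes>\<^sub>M (\<Pi>\<^sub>M i\<in>{1..N}. \<rho>)) borel (\<lambda>(\<omega>, x). (\<Sum>i=1..N. C i \<omega> *v x i) + Q \<omega>)"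

definition is_solution ::
  "'a measure \<Rightarrow> nat \<Rightarrow> (nat \<Rightarrow> 'a \<Rightarrow> real ^ 'n ^ 'n) \<Rightarrow> ('a \<Rightarrow> real ^ 'n) \<Rightarrow>
   'b measure \<Rightarrow> ('b \<Rightarrow> real ^ 'n) \<Rightarrow> bool" where
  "is_solution M N C Q P R \<longleftrightarrow>
     prob_space P \<and> R \<in> borel_measurable P \<and>
     distr P borel R = smoothing_transform M N C Q (distr P borel R)"

text \<open>Each of the two cases comprises the conditions on the data and on the parameters \<open>r\<close> and
  \<open>S\<close>, and the properties which single out the solution \<open>R\<close> uniquely in law.\<close>

definition case_H ::
  "'a measure \<Rightarrow> nat \<Rightarrow> (nat \<Rightarrow> 'a \<Rightarrow> real ^ 'n ^ 'n) \<Rightarrow> ('a \<Rightarrow> real ^ 'n) \<Rightarrow> real \<Rightarrow> real \<Rightarrow>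
   real ^ 'n \<Rightarrow> real ^ 'n ^ 'n \<Rightarrow> 'b measure \<Rightarrow> ('b \<Rightarrow> real ^ 'n) \<Rightarrow> bool" where
  "case_H M N C Q \<alpha> \<beta> r S P R \<longleftrightarrow>
     (AE \<omega> in M. Q \<omega> = 0) \<and> \<alpha> \<le> 2 \<and>
     integrable (law_C M N C) (\<lambda>c. c) \<and>
     r = real N *\<^sub>R ((\<integral>c. c \<partial>law_C M N C) *v r) \<and>
     (\<alpha> = 2 \<longrightarrow> pos_def_matrix S \<and>
        S = real N *\<^sub>R (\<integral>c. c ** S ** transpose c \<partial>law_C M N C)) \<and>
     is_solution M N C Q P R \<and>
     integrable P R \<and> (\<integral>\<omega>. R \<omega> \<partial>P) = r \<and>
     (\<forall>s. 0 < s \<and> s < \<beta> \<longrightarrow> moment P (\<lambda>\<omega>. norm (R \<omega>)) s < \<infinity>) \<and>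
     (\<alpha> = 2 \<longrightarrow> (\<integral>\<omega>. outer (R \<omega> - r) (R \<omega> - r) \<partial>P) = S)"

definition case_I ::
  "'a measure \<Rightarrow> nat \<Rightarrow> (nat \<Rightarrow> 'a \<Rightarrow> real ^ 'n ^ 'n) \<Rightarrow> ('a \<Rightarrow> real ^ 'n) \<Rightarrow> real \<Rightarrow> real \<Rightarrow>
   real ^ 'n \<Rightarrow> 'b measure \<Rightarrow> ('b \<Rightarrow> real ^ 'n) \<Rightarrow> bool" where
  "case_I M N C Q \<alpha> \<beta> r P R \<longleftrightarrow>
     0 < \<alpha> \<and> \<alpha> < 2 \<and>
     (\<alpha> \<ge> 1 \<longrightarrow> r = real N *\<^sub>R ((\<integral>c. c \<partial>law_C M N C) *v r) + (\<integral>\<omega>. Q \<omega> \<partial>M)) \<and>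
     (\<exists>s>\<alpha>. ereal s < min (s_infty (law_C M N C)) 2 \<and> moment M (\<lambda>\<omega>. norm (Q \<omega>)) s < \<infinity>) \<and>
     is_solution M N C Q P R \<and>
     (\<alpha> \<ge> 1 \<longrightarrow> integrable P R \<and> (\<integral>\<omega>. R \<omega> \<partial>P) = r) \<and>
     (\<forall>s. 0 < s \<and> s < \<beta> \<longrightarrow> moment P (\<lambda>\<omega>. norm (R \<omega>)) s < \<infinity>)"


text \<open>A continuous compactly supported function on \<open>\<real>\<^sup>d \<setminus> {0}\<close> is represented by its extension
  by zero to \<open>\<real>\<^sup>d\<close>; the condition off \<open>K\<close> includes \<open>f 0 = 0\<close>.\<close>

definition Cc_punctured :: "(real ^ 'n \<Rightarrow> real) set" where
  "Cc_punctured = {f. continuous_on (- {0}) f \<and> (\<exists>K. compact K \<and> K \<subseteq> - {0} \<and> (\<forall>x. x \<notin> K \<longrightarrow> f x = 0))}"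

text \<open>On \<open>\<real>\<^sup>d \<setminus> {0}\<close> every Borel measure which is finite on compact sets is regular.\<close>

definition radon_punctured :: "(real ^ 'n) measure \<Rightarrow> bool" where
  "radon_punctured \<Lambda> \<longleftrightarrow>
     sets \<Lambda> = sets (restrict_space borel (- {0})) \<and>
     (\<forall>K. compact K \<and> K \<subseteq> - {0} \<longrightarrow> emeasure \<Lambda> K < \<infinity>)"

definition is_tail_measure ::
  "(real ^ 'n ^ 'n) measure \<Rightarrow> real \<Rightarrow> 'b measure \<Rightarrow> ('b \<Rightarrow> real ^ 'n) \<Rightarrow> (real ^ 'n) measure \<Rightarrow> bool" where
  "is_tail_measure \<mu> \<beta> P R \<Lambda> \<longleftrightarrow>
     radon_punctured \<Lambda> \<and>
     (\<forall>f\<in>Cc_punctured.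
        ((\<lambda>a. opnorm a powr (- \<beta>) * (\<integral>\<omega>. f (a *v R \<omega>) \<partial>P)) \<longlongrightarrow> (\<integral>x. f x \<partial>\<Lambda>))
          (opnorm going_to (at_right 0) within (G_gen \<mu>)))"

definition is_spherical_part :: "real \<Rightarrow> (real ^ 'n) measure \<Rightarrow> (real ^ 'n) measure \<Rightarrow> bool" where
  "is_spherical_part \<beta> \<Lambda> \<sigma> \<longleftrightarrow>
     sets \<sigma> = sets (restrict_space borel (sphere 0 1)) \<and> finite_measure \<sigma> \<and>
     (\<forall>f\<in>Cc_punctured.
        (\<integral>x. f x \<partial>\<Lambda>) = (LINT t:{0<..}|lborel. (\<integral>w. f (t *\<^sub>R w) \<partial>\<sigma>) * t powr (- 1 - \<beta>)))"

end

theory Submission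
  imports Defs "HOL-Complex_Analysis.Complex_Analysis"
begin

text \<open>The case \<open>K > 0\<close> is a matter of reading off mass from the tail measure. Nonarithmeticity puts
  into \<open>G_gen \<mu>\<close> an element whose norm is not \<open>1\<close>, and its powers (or those of its inverse) supply
  \<open>a\<^sub>n\<close> with \<open>opnorm a\<^sub>n = q\<^sup>n\<close>, \<open>q < 1\<close>. A radial bump \<open>f\<close> that is \<open>1\<close> on the annulus \<open>1 < |x| \<le> 2\<close> then
  satisfies, with \<open>t = q\<^sup>-\<^sup>n\<close>, the bound \<open>t\<^sup>\<beta> E f(a\<^sub>n R) \<ge> t\<^sup>\<beta> (P(|R| > t) - P(|R| > 2 t))\<close>, and the right-hand
  side tends to \<open>K (1 - 2\<^sup>-\<^sup>\<beta>) > 0\<close>. Hence \<open>f\<close> has a positive \<open>\<Lambda>\<close>-integral, which a vanishing \<open>\<sigma>\<close> excludes.\<close>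

text \<open>The case \<open>K = 0\<close> rests on Landau's lemma: if the transform \<open>F(s) = E |R|\<^sup>s\<close>, finite for \<open>s < \<gamma>\<close>, extends
  holomorphically to a neighbourhood of \<open>\<gamma>\<close>, then \<open>F\<close> is finite slightly beyond \<open>\<gamma>\<close>, because \<open>F\<close> is a
  power series with nonnegative coefficients up to a part that is harmless near \<open>\<gamma>\<close>
  (\<open>landau_exp_moment\<close>, \<open>landau_moment\<close>). The extension comes from the fixed point equation. Write \<open>m(s)\<close>
  for \<open>\<Sum>\<^sub>i E \<parallel>C\<^sub>i\<parallel>\<^sup>s\<close>, \<open>R\<^sub>i\<close> for the independent copies of \<open>R\<close>, and \<open>W\<close> for \<open>\<Sum>\<^sub>i C\<^sub>i R\<^sub>i + Q\<close>. For \<open>s < \<gamma>\<close>,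
  \<open>(1 - m(s)) F(s) = E (|W|\<^sup>s - \<Sum>\<^sub>i |C\<^sub>i R\<^sub>i|\<^sup>s)\<close>. A sum of vectors has almost the norm of its largest
  term, so the defect on the right is controlled by \<open>E |Q|\<^sup>s\<close> and products such as
  \<open>|C\<^sub>i R\<^sub>i|\<^sup>e |C\<^sub>l R\<^sub>l|\<^sup>s\<^sup>-\<^sup>e\<close> with \<open>i \<noteq> l\<close>; by
  independence these need only moments of \<open>R\<close> of orders \<open>e\<close> and \<open>s - e\<close>, both below \<open>\<gamma>\<close> even when \<open>s\<close> is a
  little larger than \<open>\<gamma>\<close>. So the right-hand side is holomorphic around \<open>\<gamma>\<close> (\<open>holomorphic_defect\<close>), and
  \<open>F\<close> extends to a meromorphic function there.\<close>

text \<open>The only possible obstacle is a zero of \<open>1 - m\<close>. By the definition of \<open>\<beta>\<close> as a supremum there is none in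
  \<open>(\<beta>, s\<^sub>\<infinity>)\<close>, and at \<open>\<beta>\<close> itself \<open>K = 0\<close> gives \<open>(\<beta> - s) F(s) \<rightarrow> 0\<close> as \<open>s\<close> increases to \<open>\<beta>\<close>
  (\<open>moment_at_critical_exponent\<close>); a pole is incompatible with this, so the singularity is removable
  (\<open>moment_beyond_removable\<close>). Thus the supremum of the exponents with \<open>F(s)\<close> finite, which is at least \<open>\<beta>\<close>,
  cannot lie strictly below \<open>s\<^sub>\<infinity>\<close> (\<open>moment_step\<close>, \<open>all_moments_finite\<close>).\<close>

section \<open>Exponential moments as holomorphic functions\<close>
lemma exp_strip_bound:
  fixes a b s d u :: real
  assumes "a \<le> s - d" "s + d \<le> b" "0 \<le> d"
  shows "exp (s * u + d * \<bar>u\<bar>) \<le> exp (a * u) + exp (b * u)"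
proof (cases "u \<ge> 0")
  case True
  have "(s + d) * u \<le> b * u" using assms True by (intro mult_right_mono) auto
  then have "exp (s * u + d * \<bar>u\<bar>) \<le> exp (b * u)" using True by (simp add: algebra_simps)
  then show ?thesis by (smt (verit) exp_gt_zero)
next
  case False
  have "(s - d) * u \<le> a * u" using assms False by (intro mult_right_mono_neg) auto
  then have "exp (s * u + d * \<bar>u\<bar>) \<le> exp (a * u)" using False by (simp add: algebra_simps)
  then show ?thesis by (smt (verit) exp_gt_zero)
qed

text \<open>Expanding \<open>exp (w u)\<close> under the integral is legitimate because the sum of the absolute values of all
  terms is \<open>\<bar>h\<bar> exp (Re z u + \<bar>w\<bar> \<bar>u\<bar>)\<close>, which \<open>\<bar>h\<bar> (exp (a u) + exp (b u))\<close> dominates. Keeping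
  the coefficients explicit serves Landau's lemma, where their sign matters.\<close>
lemma exp_moment_power_series:
  fixes h u :: "'a \<Rightarrow> real"
  assumes [measurable]: "h \<in> borel_measurable \<nu>" "u \<in> borel_measurable \<nu>"
    and ia: "integrable \<nu> (\<lambda>x. h x * exp (a * u x))"
    and ib: "integrable \<nu> (\<lambda>x. h x * exp (b * u x))"
    and w: "a \<le> Re z - norm w" "Re z + norm w \<le> b"
  shows "(\<lambda>k. (\<integral>x. complex_of_real (h x) * exp (z * complex_of_real (u x)) * of_real (u x) ^ k \<partial>\<nu>) / fact k * w ^ k) sums
           (\<integral>x. complex_of_real (h x) * exp ((z + w) * complex_of_real (u x)) \<partial>\<nu>)" (is ?A)
    and "w \<noteq> 0 \<Longrightarrow> integrable \<nu> (\<lambda>x. complex_of_real (h x) * exp (z * complex_of_real (u x)) * of_real (u x) ^ k)" (is "_ \<Longrightarrow> ?B")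
proof -
  define G where "G x = \<bar>h x * exp (a * u x)\<bar> + \<bar>h x * exp (b * u x)\<bar>" for x
  define f where "f k x = complex_of_real (h x) * exp (z * complex_of_real (u x)) * of_real (u x) ^ k / fact k * w ^ k" for k x
  have [measurable]: "f k \<in> borel_measurable \<nu>" for k
    unfolding f_def by measurable
  have iG: "integrable \<nu> G" unfolding G_def using ia ib by (intro Bochner_Integration.integrable_add integrable_abs)
  have G0: "0 \<le> G x" for x unfolding G_def by auto
  have nf: "norm (f k x) = \<bar>h x\<bar> * exp (Re z * u x) * ((norm w * \<bar>u x\<bar>) ^ k /\<^sub>R fact k)" for k x
  proof -
    have "norm (fact k :: complex) = fact k" by (rule norm_fact)
    then show ?thesis
      unfolding f_def norm_mult norm_divide norm_power norm_exp_eq_Re power_mult_distrib by (simp add: divide_inverse mult_ac)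
  qed
  have nsums: "(\<lambda>k. norm (f k x)) sums (\<bar>h x\<bar> * exp (Re z * u x) * exp (norm w * \<bar>u x\<bar>))" for x
    unfolding nf by (intro sums_mult exp_converges)
  have nle: "\<bar>h x\<bar> * exp (Re z * u x) * exp (norm w * \<bar>u x\<bar>) \<le> G x" for x
  proof -
    have "\<bar>h x\<bar> * exp (Re z * u x + norm w * \<bar>u x\<bar>) \<le> \<bar>h x\<bar> * (exp (a * u x) + exp (b * u x))"
      using w by (intro mult_left_mono exp_strip_bound) auto
    then show ?thesis by (simp add: G_def exp_add abs_mult algebra_simps)
  qed
  have psum: "(\<Sum>k<n. norm (f k x)) \<le> G x" for n x
    using sum_le_suminf[OF sums_summable[OF nsums], of "{..<n}" x] sums_unique[OF nsums, of x] nle[of x] by auto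
  have single: "norm (f k x) \<le> G x" for k x
    using sum_le_suminf[OF sums_summable[OF nsums], of "{k}" x] sums_unique[OF nsums, of x] nle[of x] by auto
  have intf: "integrable \<nu> (f k)" for k
    by (rule Bochner_Integration.integrable_bound[OF iG]) (use single G0 in auto)
  have summ: "summable (\<lambda>k. \<integral>x. norm (f k x) \<partial>\<nu>)"
  proof (rule summableI_nonneg_bounded)
    show "(\<Sum>k<n. \<integral>x. norm (f k x) \<partial>\<nu>) \<le> (\<integral>x. G x \<partial>\<nu>)" for n
    proof -
      have "(\<Sum>k<n. \<integral>x. norm (f k x) \<partial>\<nu>) = (\<integral>x. (\<Sum>k<n. norm (f k x)) \<partial>\<nu>)"
        by (subst Bochner_Integration.integral_sum) (auto intro: integrable_norm intf)
      also have "\<dots> \<le> (\<integral>x. G x \<partial>\<nu>)"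
        by (intro integral_mono psum iG Bochner_Integration.integrable_sum integrable_norm intf)
      finally show ?thesis .
    qed
  qed auto
  have fs: "(\<lambda>k. f k x) sums (complex_of_real (h x) * exp ((z + w) * complex_of_real (u x)))" for x
  proof -
    have "(\<lambda>k. complex_of_real (h x) * exp (z * complex_of_real (u x)) * ((w * of_real (u x)) ^ k /\<^sub>R fact k)) sums
          (complex_of_real (h x) * exp (z * complex_of_real (u x)) * exp (w * of_real (u x)))"
      by (intro sums_mult exp_converges)
    then show ?thesis
      by (simp add: f_def[abs_def] exp_add[symmetric] algebra_simps power_mult_distrib scaleR_conv_of_real divide_inverse)
  qed
  have "(\<lambda>k. \<integral>x. f k x \<partial>\<nu>) sums (\<integral>x. (\<Sum>k. f k x) \<partial>\<nu>)"
    by (rule sums_integral[OF intf _ summ]) (use nsums in \<open>auto simp: sums_iff\<close>)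
  moreover have "(\<Sum>k. f k x) = complex_of_real (h x) * exp ((z + w) * complex_of_real (u x))" for x
    using fs by (simp add: sums_iff)
  moreover have "(\<integral>x. f k x \<partial>\<nu>) = (\<integral>x. complex_of_real (h x) * exp (z * complex_of_real (u x)) * of_real (u x) ^ k \<partial>\<nu>) / fact k * w ^ k" for k
    unfolding f_def by simp
  ultimately show ?A by simp
  show ?B if "w \<noteq> 0"
  proof -
    have "integrable \<nu> (\<lambda>x. f k x * (fact k / w ^ k))"
      using intf by simp
    then show ?thesis using that by (simp add: f_def)
  qed
qed

lemma holomorphic_exp_moment:
  fixes h u :: "'a \<Rightarrow> real"
  assumes m: "h \<in> borel_measurable \<nu>" "u \<in> borel_measurable \<nu>"
    and ia: "integrable \<nu> (\<lambda>x. h x * exp (a * u x))"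
    and ib: "integrable \<nu> (\<lambda>x. h x * exp (b * u x))"
  shows "(\<lambda>z. \<integral>x. complex_of_real (h x) * exp (z * complex_of_real (u x)) \<partial>\<nu>)
           holomorphic_on {z. a < Re z \<and> Re z < b}"
proof -
  have "(\<lambda>z. \<integral>x. complex_of_real (h x) * exp (z * complex_of_real (u x)) \<partial>\<nu>) holomorphic_on
         ball z (min (Re z - a) (b - Re z))" for z
  proof (rule power_series_holomorphic)
    fix v assume "v \<in> ball z (min (Re z - a) (b - Re z))"
    then have "a \<le> Re z - norm (v - z)" "Re z + norm (v - z) \<le> b"
      by (auto simp: dist_norm norm_minus_commute)
    from exp_moment_power_series(1)[OF m ia ib this]
    show "(\<lambda>k. (\<integral>x. complex_of_real (h x) * exp (z * complex_of_real (u x)) * of_real (u x) ^ k \<partial>\<nu>) / fact k * (v - z) ^ k)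
       sums (\<integral>x. complex_of_real (h x) * exp (v * complex_of_real (u x)) \<partial>\<nu>)" by simp
  qed
  then have "\<forall>z\<in>{z. a < Re z \<and> Re z < b}. (\<lambda>z. \<integral>x. complex_of_real (h x) * exp (z * complex_of_real (u x)) \<partial>\<nu>) field_differentiable at z"
    by (metis (no_types, lifting) holomorphic_on_imp_differentiable_at[OF _ open_ball] centre_in_ball mem_Collect_eq min_less_iff_conj diff_gt_0_iff_gt)
  then show ?thesis
    unfolding holomorphic_on_def using field_differentiable_at_within by blast
qed

lemma powser_coeffs_unique:
  fixes a b :: "nat \<Rightarrow> complex"
  assumes "0 < r" and "\<And>w. norm w < r \<Longrightarrow> (\<lambda>n. a n * w ^ n) sums f w"
    and "\<And>w. norm w < r \<Longrightarrow> (\<lambda>n. b n * w ^ n) sums f w"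
  shows "a = b"
proof -
  have "f has_fps_expansion Abs_fps c" if c: "\<And>w. norm w < r \<Longrightarrow> (\<lambda>n. c n * w ^ n) sums f w" for c
  proof -
    have "summable (\<lambda>n. c n * complex_of_real (r/2) ^ n)"
      using \<open>0 < r\<close> by (intro sums_summable[OF c]) simp
    then have "ereal (norm (complex_of_real (r/2))) \<le> conv_radius c"
      by (rule conv_radius_geI)
    moreover have "0 < ereal (norm (complex_of_real (r/2)))"
      using \<open>0 < r\<close> by simp
    ultimately have "0 < conv_radius c" by (rule less_le_trans[rotated])
    then have "fps_conv_radius (Abs_fps c) > 0" by (simp add: fps_conv_radius_def)
    moreover have "eventually (\<lambda>z. z \<in> ball 0 r) (nhds (0::complex))"
      using \<open>0 < r\<close> by (intro eventually_nhds_in_open) simp_all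
    then have "eventually (\<lambda>z. eval_fps (Abs_fps c) z = f z) (nhds 0)"
    proof eventually_elim
      case (elim z)
      then have "norm z < r" by simp
      from sums_unique[OF c[OF this]] show ?case by (simp add: eval_fps_def)
    qed
    ultimately show ?thesis by (simp add: has_fps_expansion_def)
  qed
  from this[OF assms(2)] this[OF assms(3)] have "Abs_fps a = Abs_fps b"
    by (metis fps_expansion_unique_complex)
  then show ?thesis by (metis fps_nth_Abs_fps ext)
qed

text \<open>Landau's lemma. Centre the power series of the moment at \<open>s0 = \<gamma> - \<rho> / 4\<close>. Its coefficients
  \<open>\<integral> h exp (s0 u) u\<^sup>k / k!\<close> are nonnegative and agree with the Taylor coefficients of \<open>g\<close>, whose radius of
  convergence is at least \<open>3 \<rho> / 4\<close>, so the series converges at \<open>s0 + \<rho> / 2\<close>, beyond \<open>\<gamma>\<close>. Since all terms are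
  nonnegative, sum and integral may be exchanged there without knowing integrability in advance.\<close>
lemma landau_exp_moment:
  fixes h u :: "'a \<Rightarrow> real"
  assumes [measurable]: "h \<in> borel_measurable \<nu>" "u \<in> borel_measurable \<nu>"
    and h0: "\<And>x. h x \<ge> 0" and u0: "\<And>x. u x \<ge> 0"
    and \<rho>: "0 < \<rho>" and g: "g holomorphic_on ball (complex_of_real \<gamma>) \<rho>"
    and int: "\<And>s. \<gamma> - \<rho> < s \<Longrightarrow> s < \<gamma> \<Longrightarrow> integrable \<nu> (\<lambda>x. h x * exp (s * u x))"
    and eq: "\<And>s. \<gamma> - \<rho> < s \<Longrightarrow> s < \<gamma> \<Longrightarrow> g (complex_of_real s) = complex_of_real (\<integral>x. h x * exp (s * u x) \<partial>\<nu>)"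
  shows "\<exists>s>\<gamma>. integrable \<nu> (\<lambda>x. h x * exp (s * u x))"
proof -
  define s0 where "s0 = \<gamma> - \<rho> / 4"
  define a b where "a = s0 - \<rho>/8" and "b = s0 + \<rho>/8"
  have ia: "integrable \<nu> (\<lambda>x. h x * exp (a * u x))" and ib: "integrable \<nu> (\<lambda>x. h x * exp (b * u x))"
    using \<rho> by (auto intro!: int simp: a_def b_def s0_def)
  define \<phi> where "\<phi> z = (\<integral>x. complex_of_real (h x) * exp (z * complex_of_real (u x)) \<partial>\<nu>)" for z
  define c where "c k = (\<integral>x. h x * exp (s0 * u x) * u x ^ k \<partial>\<nu>) / fact k" for k
  define B where "B = ball (complex_of_real s0) (\<rho>/8)"
  have B_sub: "B \<subseteq> ball (complex_of_real \<gamma>) \<rho>" "B \<subseteq> {z. a < Re z \<and> Re z < b}"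
  proof -
    have "dist (complex_of_real s0) (complex_of_real \<gamma>) = \<rho>/4"
      using \<rho> by (simp add: s0_def dist_norm del: of_real_diff flip: of_real_diff)
    then show "B \<subseteq> ball (complex_of_real \<gamma>) \<rho>"
      unfolding B_def using \<rho> by (simp add: ball_subset_ball_iff)
    show "B \<subseteq> {z. a < Re z \<and> Re z < b}"
    proof
      fix z assume "z \<in> B"
      then have "norm (z - complex_of_real s0) < \<rho>/8" by (simp add: B_def dist_norm norm_minus_commute)
      then have "\<bar>Re (z - complex_of_real s0)\<bar> < \<rho>/8" using abs_Re_le_cmod le_less_trans by blast
      then show "z \<in> {z. a < Re z \<and> Re z < b}" unfolding a_def b_def abs_less_iff by simp
    qed
  qed
  have hol_\<phi>: "\<phi> holomorphic_on B"
    unfolding \<phi>_def by (rule holomorphic_on_subset[OF holomorphic_exp_moment B_sub(2)]) (fact assms ia ib)+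
  have hol_g: "g holomorphic_on B" using holomorphic_on_subset[OF g B_sub(1)] .
  have \<phi>_ps: "(\<lambda>k. complex_of_real (c k) * w ^ k) sums \<phi> (s0 + w)" if "norm w < \<rho>/8" for w :: complex
  proof -
    have "a \<le> Re (complex_of_real s0) - norm w" "Re (complex_of_real s0) + norm w \<le> b"
      using that by (auto simp: a_def b_def)
    from exp_moment_power_series(1)[OF _ _ ia ib this]
    have "(\<lambda>k. (\<integral>x. complex_of_real (h x * exp (s0 * u x) * u x ^ k) \<partial>\<nu>) / fact k * w ^ k) sums \<phi> (s0 + w)"
      by (simp add: \<phi>_def exp_of_real[symmetric])
    then show ?thesis unfolding integral_complex_of_real by (simp add: c_def)
  qed
  \<comment> \<open>The hypothesis compares \<open>g\<close> with the moment only on a real segment; the identity theorem extends this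
  to a complex disc.\<close>
  have agree: "g z = \<phi> z" if "z \<in> B" for z
  proof -
    define U where "U = complex_of_real ` {s0 - \<rho>/8 <..< s0 + \<rho>/8}"
    have lim: "complex_of_real s0 islimpt U"
    proof -
      have "s0 islimpt {s0 - \<rho>/8 <..< s0 + \<rho>/8}" using \<rho> by (intro open_imp_islimpt) auto
      then show ?thesis unfolding U_def
        by (intro islimpt_isCont_image continuous_intros)
           (auto simp: eventually_at_filter)
    qed
    have "g z - \<phi> z = 0"
    proof (rule analytic_continuation[of "\<lambda>z. g z - \<phi> z" B U "complex_of_real s0"])
      show "(\<lambda>z. g z - \<phi> z) holomorphic_on B" by (intro holomorphic_intros hol_g hol_\<phi>)
      show "open B" "connected B" by (auto simp: B_def)
      show "complex_of_real s0 \<in> B" using \<rho> by (auto simp: B_def)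
      show "U \<subseteq> B" 
      proof
        fix z assume "z \<in> U"
        then obtain s where s: "z = of_real s" "s0 - \<rho>/8 < s" "s < s0 + \<rho>/8" by (auto simp: U_def)
        then have "\<bar>s0 - s\<bar> < \<rho>/8" unfolding abs_less_iff by linarith
        then show "z \<in> B" by (simp add: s(1) B_def dist_of_real dist_real_def)
      qed
      show "g z - \<phi> z = 0" if zU: "z \<in> U" for z
      proof -
        obtain s where s: "z = of_real s" "s0 - \<rho>/8 < s" "s < s0 + \<rho>/8" using zU by (auto simp: U_def)
        have "\<phi> z = (\<integral>x. complex_of_real (h x * exp (s * u x)) \<partial>\<nu>)"
          by (simp add: \<phi>_def s(1) exp_of_real[symmetric])
        then have "\<phi> z = of_real (\<integral>x. h x * exp (s * u x) \<partial>\<nu>)" by (simp only: integral_complex_of_real)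
        moreover have "g z = of_real (\<integral>x. h x * exp (s * u x) \<partial>\<nu>)"
          unfolding s(1) using s \<rho> by (intro eq) (auto simp: s0_def)
        ultimately show ?thesis by simp
      qed
    qed (use lim that in auto)
    then show ?thesis by simp
  qed
  have g_ps: "(\<lambda>k. (deriv ^^ k) g (complex_of_real s0) / fact k * w ^ k) sums g (s0 + w)" if "norm w < 3*\<rho>/4" for w :: complex
  proof -
    have "g holomorphic_on ball (complex_of_real s0) (3*\<rho>/4)"
    proof (rule holomorphic_on_subset[OF g])
      have "dist (complex_of_real s0) (complex_of_real \<gamma>) = \<rho>/4"
        using \<rho> by (simp add: s0_def dist_norm del: of_real_diff flip: of_real_diff)
      then show "ball (complex_of_real s0) (3*\<rho>/4) \<subseteq> ball (complex_of_real \<gamma>) \<rho>"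
        using \<rho> by (simp add: ball_subset_ball_iff)
    qed
    from holomorphic_power_series[OF this, of "s0 + w"] that show ?thesis by (simp add: dist_norm)
  qed
  have coeff: "(\<lambda>k. (deriv ^^ k) g (complex_of_real s0) / fact k) = (\<lambda>k. complex_of_real (c k))"
  proof (rule powser_coeffs_unique[of "\<rho>/8" _ "\<lambda>w. g (s0 + w)"])
    show "(\<lambda>k. complex_of_real (c k) * w ^ k) sums g (s0 + w)" if "norm w < \<rho>/8" for w :: complex
      using \<phi>_ps[OF that] agree[of "s0 + w"] that by (simp add: B_def dist_norm)
  qed (use \<rho> g_ps in auto)
  define \<eta> where "\<eta> = \<rho>/2"
  have "summable (\<lambda>k. complex_of_real (c k) * of_real \<eta> ^ k)"
    using g_ps[of "of_real \<eta>"] \<rho> fun_cong[OF coeff] by (auto simp: sums_iff \<eta>_def)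
  then have summ: "summable (\<lambda>k. c k * \<eta> ^ k)"
    by (simp add: summable_of_real_iff flip: of_real_power of_real_mult)
  have ck: "integrable \<nu> (\<lambda>x. h x * exp (s0 * u x) * u x ^ k)" for k
  proof -
    have "integrable \<nu> (\<lambda>x. complex_of_real (h x) * exp (of_real s0 * complex_of_real (u x)) * of_real (u x) ^ k)"
      using \<rho> by (intro exp_moment_power_series(2)[OF _ _ ia ib, of _ "of_real (\<rho>/16)"]) (auto simp: a_def b_def)
    then have "integrable \<nu> (\<lambda>x. complex_of_real (h x * exp (s0 * u x) * u x ^ k))"
      by (simp add: exp_of_real[symmetric])
    then show ?thesis by (simp only: complex_of_real_integrable_eq)
  qed
  have \<eta>0: "\<eta> \<ge> 0" using \<rho> by (simp add: \<eta>_def)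
  have "(\<integral>\<^sup>+x. ennreal (h x * exp ((s0 + \<eta>) * u x)) \<partial>\<nu>) =
        (\<integral>\<^sup>+x. (\<Sum>k. ennreal (h x * exp (s0 * u x) * u x ^ k / fact k * \<eta> ^ k)) \<partial>\<nu>)"
  proof (rule nn_integral_cong)
    fix x
    have "(\<lambda>k. h x * exp (s0 * u x) * ((\<eta> * u x) ^ k /\<^sub>R fact k)) sums (h x * exp (s0 * u x) * exp (\<eta> * u x))"
      by (intro sums_mult exp_converges)
    then have "(\<lambda>k. h x * exp (s0 * u x) * u x ^ k / fact k * \<eta> ^ k) sums (h x * exp ((s0 + \<eta>) * u x))"
      by (simp add: exp_add algebra_simps power_mult_distrib divide_inverse)
    then show "ennreal (h x * exp ((s0 + \<eta>) * u x)) = (\<Sum>k. ennreal (h x * exp (s0 * u x) * u x ^ k / fact k * \<eta> ^ k))"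
      using h0[of x] u0[of x] \<eta>0 by (subst suminf_ennreal2) (auto simp: sums_iff)
  qed
  also have "\<dots> = (\<Sum>k. \<integral>\<^sup>+x. ennreal (h x * exp (s0 * u x) * u x ^ k / fact k * \<eta> ^ k) \<partial>\<nu>)"
    by (rule nn_integral_suminf) measurable
  also have "\<dots> = (\<Sum>k. ennreal (c k * \<eta> ^ k))"
    using h0 u0 \<eta>0 ck by (subst nn_integral_eq_integral) (auto simp: c_def)
  also have "\<dots> = ennreal (\<Sum>k. c k * \<eta> ^ k)"
    using summ h0 u0 \<eta>0 by (intro suminf_ennreal2) (auto simp: c_def intro!: mult_nonneg_nonneg divide_nonneg_nonneg integral_nonneg_AE)
  finally have "(\<integral>\<^sup>+x. ennreal (h x * exp ((s0 + \<eta>) * u x)) \<partial>\<nu>) < \<infinity>" by simp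
  then have "integrable \<nu> (\<lambda>x. h x * exp ((s0 + \<eta>) * u x))"
    using h0 by (intro integrableI_nonneg) auto
  moreover have "s0 + \<eta> > \<gamma>" using \<rho> by (simp add: s0_def \<eta>_def)
  ultimately show ?thesis by blast
qed

section \<open>The defect of a sum of vectors\<close>

text \<open>Indicator of \<open>{v. exp v < a}\<close>. On the logarithmic scale \<open>v\<close> a power \<open>a\<^sup>s / s\<close> is the exponential moment of
  order \<open>s\<close> of this indicator, so differences of powers become exponential moments of one fixed weight.\<close>
definition below :: "real \<Rightarrow> real \<Rightarrow> real" where
  "below a v = (if exp v < a then 1 else 0)"

lemma below_measurable [measurable (raw)]:
  assumes [measurable]: "f \<in> borel_measurable M" "g \<in> borel_measurable M"
  shows "(\<lambda>x. below (f x) (g x)) \<in> borel_measurable M"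
  unfolding below_def by measurable

lemma below_nonneg: "0 \<le> below a v" by (simp add: below_def)

lemma nn_integral_below:
  assumes "0 \<le> a" "0 < s"
  shows "(\<integral>\<^sup>+v. ennreal (below a v * exp (s * v)) \<partial>lborel) = ennreal (a powr s / s)"
proof (cases "a = 0")
  case True
  then show ?thesis by (simp add: below_def)
next
  case False
  then have a: "0 < a" using assms by simp
  have "(\<integral>\<^sup>+v. ennreal (below a v * exp (s * v)) \<partial>lborel) =
        (\<integral>\<^sup>+v. ennreal (below a (0 + (-1) * v) * exp (s * (0 + (-1) * v))) \<partial>lborel)"
    by (subst nn_integral_real_affine[where c = "-1" and t = 0]) auto
  also have "\<dots> = (\<integral>\<^sup>+v. ennreal (exp (- (s * v))) * indicator {- ln a..} v \<partial>lborel)"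
  proof (rule nn_integral_cong_AE)
    have eq: "(exp (- v) < a) = (- ln a < v)" for v
      using a by (metis exp_less_cancel_iff exp_ln minus_less_iff)
    show "AE v in lborel. ennreal (below a (0 + (-1) * v) * exp (s * (0 + (-1) * v))) =
            ennreal (exp (- (s * v))) * indicator {- ln a..} v"
      using AE_lborel_singleton[of "- ln a"]
      by eventually_elim (auto simp: below_def eq indicator_def)
  qed
  also have "\<dots> = ennreal (0 - (- exp (- (s * (- ln a))) / s))"
  proof (rule nn_integral_FTC_atLeast)
    show "DERIV (\<lambda>v. - exp (- (s * v)) / s) x :> exp (- (s * x))" for x
      using assms by (auto intro!: derivative_eq_intros)
    have "LIM v at_top. s * v :> at_top"
      using assms by (intro filterlim_tendsto_pos_mult_at_top[OF tendsto_const _ filterlim_ident]) auto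
    then have "LIM v at_top. - (s * v) :> at_bot"
      by (simp add: filterlim_uminus_at_top)
    then have "((\<lambda>v. exp (- (s * v))) \<longlongrightarrow> 0) at_top"
      by (rule filterlim_compose[OF exp_at_bot])
    then have "((\<lambda>v. - exp (- (s * v)) / s) \<longlongrightarrow> - 0 / s) at_top"
      by (intro tendsto_intros) (use assms in auto)
    then show "((\<lambda>v. - exp (- (s * v)) / s) \<longlongrightarrow> 0) at_top" by simp
  qed auto
  also have "0 - (- exp (- (s * (- ln a))) / s) = a powr s / s"
    using a by (simp add: powr_def)
  finally show ?thesis .
qed

lemma has_integral_below:
  assumes "0 \<le> a" "0 < s"
  shows "has_bochner_integral lborel (\<lambda>v. below a v * exp (s * v)) (a powr s / s)"
  by (rule has_bochner_integral_nn_integral)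
     (use assms in \<open>auto simp: nn_integral_below below_nonneg\<close>)

text \<open>For \<open>s \<le> 1\<close> the factor \<open>1\<close> suffices, for \<open>s > 1\<close> the mean value theorem gives \<open>s c\<^sup>s\<close>; the constant covers
  both.\<close>
lemma abs_powr_minus_one_le:
  fixes x s c :: real
  assumes "0 \<le> x" "x \<le> c" "1 \<le> c" "0 < s"
  shows "\<bar>x powr s - 1\<bar> \<le> (1 + s * c powr s) * \<bar>x - 1\<bar>"
proof (cases "x \<le> 0")
  case True
  then show ?thesis using assms by simp
next
  case False
  then have x: "0 < x" by simp
  consider "x = 1" | "s \<le> 1" | "s > 1" "x < 1" | "s > 1" "x > 1" by linarith
  then show ?thesis
  proof cases
    case 2
    have "\<bar>x powr s - 1\<bar> \<le> \<bar>x - 1\<bar>"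
    proof (cases "x \<le> 1")
      case True
      have "x powr 1 \<le> x powr s" using x True 2 by (intro powr_mono') auto
      moreover have "x powr s \<le> 1" using x True assms by (intro powr_le1) auto
      ultimately show ?thesis using x by simp
    next
      case False
      have "x powr s \<le> x powr 1" using False 2 by (intro powr_mono) auto
      moreover have "1 \<le> x powr s" using False assms by (intro ge_one_powr_ge_zero) auto
      ultimately show ?thesis using x by simp
    qed
    also have "\<dots> \<le> (1 + s * c powr s) * \<bar>x - 1\<bar>"
      using assms by (simp add: algebra_simps)
    finally show ?thesis .
  next
    case 3
    have der: "DERIV (\<lambda>x. x powr s) t :> s * t powr (s - 1)" if "0 < t" for t
      using has_real_derivative_powr[OF that] by simp
    obtain t where t: "x < t" "t < 1" "1 powr s - x powr s = (1 - x) * (s * t powr (s - 1))"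
      using MVT2[of x 1 "\<lambda>x. x powr s" "\<lambda>t. s * t powr (s - 1)"] 3 x der by auto
    have "t powr (s - 1) \<le> 1" using t x 3 by (intro powr_le1) auto
    also have "1 \<le> c powr s" using assms by (intro ge_one_powr_ge_zero) auto
    finally have "(1 - x) * (s * t powr (s - 1)) \<le> (1 - x) * (s * c powr s)"
      using 3 assms by (intro mult_left_mono) auto
    moreover have "0 \<le> (1 - x) * (s * t powr (s - 1))" using 3 assms by (intro mult_nonneg_nonneg) auto
    ultimately have "0 \<le> 1 - x powr s" "1 - x powr s \<le> (1 - x) * (s * c powr s)" using t(3) by simp_all
    moreover have "(1 + s * c powr s) * \<bar>x - 1\<bar> = (1 - x) + (1 - x) * (s * c powr s)"
      using 3 by (simp add: algebra_simps)
    ultimately show ?thesis using 3 by linarith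
  next
    case 4
    have der: "DERIV (\<lambda>x. x powr s) t :> s * t powr (s - 1)" if "0 < t" for t
      using has_real_derivative_powr[OF that] by simp
    obtain t where t: "1 < t" "t < x" "x powr s - 1 powr s = (x - 1) * (s * t powr (s - 1))"
      using MVT2[of 1 x "\<lambda>x. x powr s" "\<lambda>t. s * t powr (s - 1)"] 4 der by auto
    have "t powr (s - 1) \<le> c powr (s - 1)" using t assms 4 by (intro powr_mono2) auto
    also have "\<dots> \<le> c powr s" using assms by (intro powr_mono) auto
    finally have "(x - 1) * (s * t powr (s - 1)) \<le> (x - 1) * (s * c powr s)"
      using 4 assms by (intro mult_left_mono) auto
    moreover have "0 \<le> (x - 1) * (s * t powr (s - 1))" using 4 assms by (intro mult_nonneg_nonneg) auto
    ultimately have "0 \<le> x powr s - 1" "x powr s - 1 \<le> (x - 1) * (s * c powr s)" using t(3) by simp_all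
    moreover have "(1 + s * c powr s) * \<bar>x - 1\<bar> = (x - 1) + (x - 1) * (s * c powr s)"
      using 4 by (simp add: algebra_simps)
    ultimately show ?thesis using 4 by linarith
  qed simp
qed

text \<open>Only the largest vector \<open>y j\<close> matters to first order. After scaling it to norm \<open>1\<close>, the norm of the sum
  differs from \<open>1\<close> by at most the sum of the other norms, each of which is at most \<open>1\<close> and hence at most
  its own power of order \<open>e \<le> 1\<close>.\<close>
lemma powr_norm_sum_defect:
  fixes y :: "'i \<Rightarrow> 'v::real_normed_vector"
  assumes fin: "finite I" and j: "j \<in> I" and max: "\<And>i. i \<in> I \<Longrightarrow> norm (y i) \<le> norm (y j)"
    and s: "0 < e" "e \<le> 1" "e \<le> s"
  shows "\<bar>norm (\<Sum>i\<in>I. y i) powr s - norm (y j) powr s\<bar> + (\<Sum>i\<in>I-{j}. norm (y i) powr s)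
         \<le> (2 + s * real (card I) powr s) * (\<Sum>i\<in>I-{j}. norm (y i) powr e * norm (y j) powr (s - e))"
proof (cases "y j = 0")
  case True
  then have "y i = 0" if "i \<in> I" for i using max[OF that] by simp
  then show ?thesis using j by simp
next
  case False
  define m where "m = norm (y j)"
  have m: "m > 0" using False by (simp add: m_def)
  define W where "W = norm (\<Sum>i\<in>I. y i)"
  define n where "n = real (card I)"
  have n1: "1 \<le> n" unfolding n_def using fin j by (metis One_nat_def Suc_leI card_gt_0_iff empty_iff of_nat_1 of_nat_mono)
  have split: "(\<Sum>i\<in>I. y i) = y j + (\<Sum>i\<in>I-{j}. y i)" using fin j by (rule sum.remove)
  have Wm: "\<bar>W - m\<bar> \<le> (\<Sum>i\<in>I-{j}. norm (y i))"
  proof -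
    have "\<bar>W - m\<bar> \<le> norm ((\<Sum>i\<in>I. y i) - y j)" unfolding W_def m_def by (rule norm_triangle_ineq3)
    also have "\<dots> = norm (\<Sum>i\<in>I-{j}. y i)" by (simp add: split)
    finally show ?thesis using norm_sum[of y "I-{j}"] by linarith
  qed
  have "W \<le> (\<Sum>i\<in>I. norm (y i))" unfolding W_def by (rule norm_sum)
  also have "\<dots> \<le> n * m" unfolding n_def m_def by (rule sum_bounded_above) (rule max)
  finally have Wn: "W / m \<le> n" using m by (simp add: field_simps)
  have r: "norm (y i) / m \<le> (norm (y i) / m) powr e" if "i \<in> I" for i
  proof (cases "y i = 0")
    case False
    have "(norm (y i) / m) powr 1 \<le> (norm (y i) / m) powr e"
      using False max[OF that] s m by (intro powr_mono') (auto simp: m_def)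
    then show ?thesis using m by simp
  qed simp
  have mm: "m powr s * (norm (y i) / m) powr e = norm (y i) powr e * m powr (s - e)" for i
    using m by (simp add: powr_divide powr_diff)
  define \<Sigma> where "\<Sigma> = (\<Sum>i\<in>I-{j}. norm (y i) powr e * m powr (s - e))"
  have "\<bar>W powr s - m powr s\<bar> = m powr s * \<bar>(W / m) powr s - 1\<bar>"
  proof -
    have "W powr s - m powr s = m powr s * ((W / m) powr s - 1)"
      using m by (simp add: powr_divide W_def algebra_simps)
    then show ?thesis by (simp add: abs_mult)
  qed
  also have "\<dots> \<le> m powr s * ((1 + s * n powr s) * \<bar>W / m - 1\<bar>)"
    using Wn n1 s m by (intro mult_left_mono abs_powr_minus_one_le) (auto simp: W_def)
  also have "\<bar>W / m - 1\<bar> = \<bar>W - m\<bar> / m"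
    using m by (metis abs_divide abs_of_pos diff_divide_distrib divide_self less_irrefl)
  also have "m powr s * ((1 + s * n powr s) * (\<bar>W - m\<bar> / m)) \<le>
             m powr s * ((1 + s * n powr s) * (\<Sum>i\<in>I-{j}. (norm (y i) / m) powr e))"
  proof (intro mult_left_mono)
    have "\<bar>W - m\<bar> / m \<le> (\<Sum>i\<in>I-{j}. norm (y i) / m)"
      using Wm m by (simp add: divide_right_mono flip: sum_divide_distrib)
    also have "\<dots> \<le> (\<Sum>i\<in>I-{j}. (norm (y i) / m) powr e)" by (intro sum_mono r) auto
    finally show "\<bar>W - m\<bar> / m \<le> (\<Sum>i\<in>I-{j}. (norm (y i) / m) powr e)" .
  qed (use s in auto)
  also have "\<dots> = (1 + s * n powr s) * \<Sigma>"
    unfolding \<Sigma>_def mm[symmetric] by (simp add: sum_distrib_left mult_ac)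
  finally have A: "\<bar>W powr s - m powr s\<bar> \<le> (1 + s * n powr s) * \<Sigma>" .
  have "(\<Sum>i\<in>I-{j}. norm (y i) powr s) \<le> \<Sigma>"
    unfolding \<Sigma>_def
  proof (rule sum_mono)
    fix i assume i: "i \<in> I - {j}"
    have "norm (y i) powr s = norm (y i) powr e * norm (y i) powr (s - e)"
      by (simp flip: powr_add)
    also have "\<dots> \<le> norm (y i) powr e * m powr (s - e)"
      using i max s by (intro mult_left_mono powr_mono2) (auto simp: m_def)
    finally show "norm (y i) powr s \<le> norm (y i) powr e * m powr (s - e)" .
  qed
  with A show ?thesis unfolding W_def m_def n_def \<Sigma>_def by (simp add: algebra_simps)
qed

text \<open>The absolute value inside the integral is what makes the complex transform of the defect converge.
  The bound compares both parts of \<open>k\<close> with the indicator belonging to the largest vector; as the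
  index of that vector depends on the data, the final bound sums over all candidates.\<close>
lemma nn_integral_tail_defect_le:
  fixes y :: "'i \<Rightarrow> 'v::real_normed_vector"
  assumes fin: "finite I" and ne: "I \<noteq> {}" and s: "0 < e" "e \<le> 1" "e \<le> s"
  defines "k \<equiv> \<lambda>v. below (norm (\<Sum>i\<in>I. y i)) v - (\<Sum>i\<in>I. below (norm (y i)) v)"
  shows "(\<integral>\<^sup>+v. ennreal \<bar>k v * exp (s * v)\<bar> \<partial>lborel) \<le>
     ennreal ((2 + s * real (card I) powr s) / s * (\<Sum>l\<in>I. \<Sum>i\<in>I-{l}. norm (y i) powr e * norm (y l) powr (s - e)))"
proof -
  have "\<exists>j\<in>I. \<forall>i\<in>I. norm (y i) \<le> norm (y j)"
  proof -
    have "Max ((\<lambda>i. norm (y i)) ` I) \<in> (\<lambda>i. norm (y i)) ` I" using fin ne by (intro Max_in) auto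
    then obtain j where "j \<in> I" "norm (y j) = Max ((\<lambda>i. norm (y i)) ` I)" by auto
    then show ?thesis using fin by (intro bexI[of _ j]) auto
  qed
  then obtain j where j: "j \<in> I" and max: "\<And>i. i \<in> I \<Longrightarrow> norm (y i) \<le> norm (y j)" by blast
  define m where "m = norm (y j)"
  define W where "W = norm (\<Sum>i\<in>I. y i)"
  have s0: "0 < s" using s by simp
  define g where "g v = \<bar>below W v - below m v\<bar> * exp (s * v) + (\<Sum>i\<in>I-{j}. below (norm (y i)) v * exp (s * v))" for v
  have kg: "\<bar>k v * exp (s * v)\<bar> \<le> g v" for v
  proof -
    have "\<bar>k v\<bar> \<le> \<bar>below W v - below m v\<bar> + \<bar>\<Sum>i\<in>I-{j}. below (norm (y i)) v\<bar>"
      unfolding k_def W_def m_def using sum.remove[OF fin j, of "\<lambda>i. below (norm (y i)) v"] by linarith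
    also have "\<bar>\<Sum>i\<in>I-{j}. below (norm (y i)) v\<bar> = (\<Sum>i\<in>I-{j}. below (norm (y i)) v)"
      by (simp add: sum_nonneg below_nonneg)
    finally have "\<bar>k v\<bar> * exp (s * v) \<le> (\<bar>below W v - below m v\<bar> + (\<Sum>i\<in>I-{j}. below (norm (y i)) v)) * exp (s * v)"
      by (intro mult_right_mono) auto
    then show ?thesis by (simp add: g_def abs_mult distrib_right sum_distrib_right)
  qed
  have diff: "has_bochner_integral lborel (\<lambda>v. \<bar>below W v - below m v\<bar> * exp (s * v)) (\<bar>W powr s - m powr s\<bar> / s)"
  proof (cases "W \<le> m")
    case True
    then have "\<bar>below W v - below m v\<bar> * exp (s * v) = below m v * exp (s * v) - below W v * exp (s * v)" for v
      by (auto simp: below_def)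
    moreover have "\<bar>W powr s - m powr s\<bar> / s = m powr s / s - W powr s / s"
      using True s0 powr_mono2[of s W m] by (simp add: W_def diff_divide_distrib)
    ultimately show ?thesis
      using has_bochner_integral_diff[OF has_integral_below[of m s] has_integral_below[of W s]] s0
      by (simp add: m_def W_def)
  next
    case False
    then have "\<bar>below W v - below m v\<bar> * exp (s * v) = below W v * exp (s * v) - below m v * exp (s * v)" for v
      by (auto simp: below_def)
    moreover have "\<bar>W powr s - m powr s\<bar> / s = W powr s / s - m powr s / s"
      using False s0 powr_mono2[of s m W] by (simp add: m_def diff_divide_distrib)
    ultimately show ?thesis
      using has_bochner_integral_diff[OF has_integral_below[of W s] has_integral_below[of m s]] s0
      by (simp add: m_def W_def)
  qed
  have "has_bochner_integral lborel (\<lambda>v. \<Sum>i\<in>I-{j}. below (norm (y i)) v * exp (s * v)) (\<Sum>i\<in>I-{j}. norm (y i) powr s / s)"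
    by (intro has_bochner_integral_sum has_integral_below s0) auto
  from has_bochner_integral_add[OF diff this]
  have hg: "has_bochner_integral lborel g (\<bar>W powr s - m powr s\<bar> / s + (\<Sum>i\<in>I-{j}. norm (y i) powr s / s))"
    by (simp add: g_def[abs_def])
  have g0: "0 \<le> g v" for v unfolding g_def by (intro add_nonneg_nonneg sum_nonneg mult_nonneg_nonneg) (auto simp: below_nonneg)
  have "(\<integral>\<^sup>+v. ennreal \<bar>k v * exp (s * v)\<bar> \<partial>lborel) \<le> (\<integral>\<^sup>+v. ennreal (g v) \<partial>lborel)"
    by (intro nn_integral_mono ennreal_leI kg)
  also have "\<dots> = ennreal (\<bar>W powr s - m powr s\<bar> / s + (\<Sum>i\<in>I-{j}. norm (y i) powr s / s))"
    using hg g0 by (subst nn_integral_eq_integral) (auto simp: has_bochner_integral_iff)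
  also have "\<dots> \<le> ennreal ((2 + s * real (card I) powr s) / s * (\<Sum>l\<in>I. \<Sum>i\<in>I-{l}. norm (y i) powr e * norm (y l) powr (s - e)))"
  proof (rule ennreal_leI)
    have "\<bar>W powr s - m powr s\<bar> / s + (\<Sum>i\<in>I-{j}. norm (y i) powr s / s) =
          (\<bar>W powr s - m powr s\<bar> + (\<Sum>i\<in>I-{j}. norm (y i) powr s)) / s"
      by (simp add: add_divide_distrib sum_divide_distrib)
    also have "\<dots> \<le> ((2 + s * real (card I) powr s) * (\<Sum>i\<in>I-{j}. norm (y i) powr e * norm (y j) powr (s - e))) / s"
      unfolding W_def m_def by (intro divide_right_mono powr_norm_sum_defect fin j max s) (use s0 in auto)
    also have "\<dots> = (2 + s * real (card I) powr s) / s * (\<Sum>i\<in>I-{j}. norm (y i) powr e * norm (y j) powr (s - e))"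
      by simp
    also have "\<dots> \<le> (2 + s * real (card I) powr s) / s * (\<Sum>l\<in>I. \<Sum>i\<in>I-{l}. norm (y i) powr e * norm (y l) powr (s - e))"
    proof (intro mult_left_mono)
      show "(\<Sum>i\<in>I-{j}. norm (y i) powr e * norm (y j) powr (s - e)) \<le> (\<Sum>l\<in>I. \<Sum>i\<in>I-{l}. norm (y i) powr e * norm (y l) powr (s - e))"
        by (rule member_le_sum[OF j _ fin, of "\<lambda>l. \<Sum>i\<in>I-{l}. norm (y i) powr e * norm (y l) powr (s - e)"]) (auto intro: sum_nonneg)
      show "0 \<le> (2 + s * real (card I) powr s) / s" using s0 by (intro divide_nonneg_nonneg add_nonneg_nonneg mult_nonneg_nonneg) auto
    qed
    finally show "\<bar>W powr s - m powr s\<bar> / s + (\<Sum>i\<in>I-{j}. norm (y i) powr s / s) \<le>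
      (2 + s * real (card I) powr s) / s * (\<Sum>l\<in>I. \<Sum>i\<in>I-{l}. norm (y i) powr e * norm (y l) powr (s - e))" .
  qed
  finally show ?thesis .
qed

section \<open>Moments beyond the abscissa of convergence\<close>
lemma nn_integral_below_pair:
  assumes "sigma_finite_measure M" and [measurable]: "X \<in> borel_measurable M"
    and X0: "\<And>x. 0 \<le> X x" and s: "0 < s"
  shows "(\<integral>\<^sup>+p. ennreal (below (X (fst p)) (snd p) * exp (s * snd p)) \<partial>(M \<Otimes>\<^sub>M lborel)) =
         (\<integral>\<^sup>+x. ennreal (X x powr s / s) \<partial>M)"
proof -
  interpret M: sigma_finite_measure M by fact
  interpret pair_sigma_finite M lborel ..
  have "(\<integral>\<^sup>+p. ennreal (below (X (fst p)) (snd p) * exp (s * snd p)) \<partial>(M \<Otimes>\<^sub>M lborel)) =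
        (\<integral>\<^sup>+x. \<integral>\<^sup>+v. ennreal (below (X x) v * exp (s * v)) \<partial>lborel \<partial>M)"
    by (subst lborel.nn_integral_fst[symmetric]) simp_all
  also have "\<dots> = (\<integral>\<^sup>+x. ennreal (X x powr s / s) \<partial>M)"
    using nn_integral_below[OF X0 s] by simp
  finally show ?thesis .
qed

lemma has_integral_below_pair:
  assumes "sigma_finite_measure M" and [measurable]: "X \<in> borel_measurable M"
    and X0: "\<And>x. 0 \<le> X x" and s: "0 < s" and int: "integrable M (\<lambda>x. X x powr s)"
  shows "has_bochner_integral (M \<Otimes>\<^sub>M lborel) (\<lambda>p. below (X (fst p)) (snd p) * exp (s * snd p))
           ((\<integral>x. X x powr s \<partial>M) / s)"
proof (rule has_bochner_integral_nn_integral)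
  have "(\<integral>\<^sup>+x. ennreal (X x powr s / s) \<partial>M) = ennreal (\<integral>x. X x powr s / s \<partial>M)"
    using s int by (intro nn_integral_eq_integral) auto
  then show "(\<integral>\<^sup>+p. ennreal (below (X (fst p)) (snd p) * exp (s * snd p)) \<partial>(M \<Otimes>\<^sub>M lborel)) =
      ennreal ((\<integral>x. X x powr s \<partial>M) / s)"
    by (simp add: nn_integral_below_pair[OF assms(1-4)])
qed (use s in \<open>auto simp: below_nonneg\<close>)

text \<open>The part of \<open>X\<close> with values in \<open>(0, 1]\<close> has all nonnegative moments, so its transform is holomorphic
  in the right half-plane and can be subtracted from \<open>g\<close>. What remains is the case of a nonnegative
  logarithm, as in Landau's lemma for exponential moments.\<close>
lemma landau_moment:
  fixes X :: "'a \<Rightarrow> real"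
  assumes "finite_measure M" and [measurable]: "X \<in> borel_measurable M" and X0: "\<And>x. 0 \<le> X x"
    and \<rho>: "0 < \<rho>" "\<rho> \<le> \<gamma>" and g: "g holomorphic_on ball (complex_of_real \<gamma>) \<rho>"
    and int: "\<And>s. \<gamma> - \<rho> < s \<Longrightarrow> s < \<gamma> \<Longrightarrow> integrable M (\<lambda>x. X x powr s)"
    and eq: "\<And>s. \<gamma> - \<rho> < s \<Longrightarrow> s < \<gamma> \<Longrightarrow> g (complex_of_real s) = complex_of_real (\<integral>x. X x powr s \<partial>M)"
  shows "\<exists>s>\<gamma>. integrable M (\<lambda>x. X x powr s)"
proof -
  interpret finite_measure M by fact
  define h1 where "h1 x = (if 1 < X x then 1 else 0 :: real)" for x
  define u1 where "u1 x = ln (max 1 (X x))" for x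
  define h2 where "h2 x = (if 0 < X x \<and> X x \<le> 1 then 1 else 0 :: real)" for x
  define u2 where "u2 x = ln (X x)" for x
  have [measurable]: "h1 \<in> borel_measurable M" "u1 \<in> borel_measurable M" "h2 \<in> borel_measurable M" "u2 \<in> borel_measurable M"
    unfolding h1_def u1_def h2_def u2_def by measurable
  have split: "X x powr s = h1 x * exp (s * u1 x) + h2 x * exp (s * u2 x)" for x s
    using X0[of x] by (auto simp: h1_def h2_def u1_def u2_def powr_def max_def)
  have i2: "integrable M (\<lambda>x. h2 x * exp (s * u2 x))" if "s \<ge> 0" for s
  proof (rule integrable_const_bound[where B = 1])
    show "AE x in M. norm (h2 x * exp (s * u2 x)) \<le> 1"
      using that by (auto simp: h2_def u2_def mult_nonneg_nonpos)
  qed measurable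
  have i1: "integrable M (\<lambda>x. h1 x * exp (s * u1 x)) \<longleftrightarrow> integrable M (\<lambda>x. X x powr s)" if "0 < s" for s
  proof
    assume "integrable M (\<lambda>x. h1 x * exp (s * u1 x))"
    then show "integrable M (\<lambda>x. X x powr s)" unfolding split using i2[of s] that by simp
  next
    assume "integrable M (\<lambda>x. X x powr s)"
    from Bochner_Integration.integrable_diff[OF this i2[of s]] that
    show "integrable M (\<lambda>x. h1 x * exp (s * u1 x))" by (simp add: split)
  qed
  define F where "F z = (\<integral>x. complex_of_real (h2 x) * exp (z * complex_of_real (u2 x)) \<partial>M)" for z
  have F_real: "F (complex_of_real s) = complex_of_real (\<integral>x. h2 x * exp (s * u2 x) \<partial>M)" for s
  proof -
    have "F (complex_of_real s) = (\<integral>x. complex_of_real (h2 x * exp (s * u2 x)) \<partial>M)"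
      by (simp add: F_def exp_of_real[symmetric])
    then show ?thesis by (simp only: integral_complex_of_real)
  qed
  have "F holomorphic_on {z. 0 < Re z \<and> Re z < 2 * \<gamma>}"
    unfolding F_def by (rule holomorphic_exp_moment) (use i2[of 0] i2[of "2 * \<gamma>"] \<rho> in auto)
  moreover have "ball (complex_of_real \<gamma>) \<rho> \<subseteq> {z. 0 < Re z \<and> Re z < 2 * \<gamma>}"
  proof
    fix z assume "z \<in> ball (complex_of_real \<gamma>) \<rho>"
    then have "norm (z - complex_of_real \<gamma>) < \<rho>" by (simp add: dist_norm norm_minus_commute)
    then have "\<bar>Re (z - complex_of_real \<gamma>)\<bar> < \<rho>" using abs_Re_le_cmod le_less_trans by blast
    then show "z \<in> {z. 0 < Re z \<and> Re z < 2 * \<gamma>}" using \<rho> by (simp add: abs_less_iff)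
  qed
  ultimately have F: "F holomorphic_on ball (complex_of_real \<gamma>) \<rho>" by (rule holomorphic_on_subset)
  have "\<exists>s>\<gamma>. integrable M (\<lambda>x. h1 x * exp (s * u1 x))"
  proof (rule landau_exp_moment)
    show "(\<lambda>z. g z - F z) holomorphic_on ball (complex_of_real \<gamma>) \<rho>" by (intro holomorphic_intros g F)
    fix s assume s: "\<gamma> - \<rho> < s" "s < \<gamma>"
    then have s0: "0 < s" using \<rho> by linarith
    show j: "integrable M (\<lambda>x. h1 x * exp (s * u1 x))" using i1[OF s0] int[OF s] by simp
    have "(\<integral>x. X x powr s \<partial>M) = (\<integral>x. h1 x * exp (s * u1 x) \<partial>M) + (\<integral>x. h2 x * exp (s * u2 x) \<partial>M)"
      unfolding split using j i2[of s] s0 by (intro Bochner_Integration.integral_add) auto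
    then show "g (complex_of_real s) - F (complex_of_real s) = complex_of_real (\<integral>x. h1 x * exp (s * u1 x) \<partial>M)"
      by (simp add: eq[OF s] F_real)
  qed (use \<rho> in \<open>auto simp: h1_def u1_def\<close>)
  then show ?thesis using i1 \<rho> by (metis less_trans order_less_le_trans)
qed

text \<open>Here \<open>D / f\<close> is a meromorphic continuation of the moment function. Its singularity at \<open>\<gamma>\<close> is not
  essential, so the behaviour along the real segment to the left of \<open>\<gamma>\<close> decides whether it is removable,
  whatever the order of the zero of \<open>f\<close>.\<close>
lemma moment_beyond_removable:
  fixes X :: "'a \<Rightarrow> real" and D f :: "complex \<Rightarrow> complex"
  assumes "finite_measure M" and [measurable]: "X \<in> borel_measurable M" and X0: "\<And>x. 0 \<le> X x"
    and \<delta>: "0 < \<delta>" "\<delta> \<le> \<gamma>"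
    and D: "D holomorphic_on ball (complex_of_real \<gamma>) \<delta>" and f: "f holomorphic_on ball (complex_of_real \<gamma>) \<delta>"
    and int: "\<And>s. \<gamma> - \<delta> < s \<Longrightarrow> s < \<gamma> \<Longrightarrow> integrable M (\<lambda>x. X x powr s)"
    and eq: "\<And>s. \<gamma> - \<delta> < s \<Longrightarrow> s < \<gamma> \<Longrightarrow>
        f (complex_of_real s) * complex_of_real (\<integral>x. X x powr s \<partial>M) = D (complex_of_real s)"
    and nz: "w \<in> ball (complex_of_real \<gamma>) \<delta>" "f w \<noteq> 0"
    and pole: "f (complex_of_real \<gamma>) = 0 \<Longrightarrow> ((\<lambda>s. (\<gamma> - s) * (\<integral>x. X x powr s \<partial>M)) \<longlongrightarrow> 0) (at_left \<gamma>)"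
  shows "\<exists>s>\<gamma>. integrable M (\<lambda>x. X x powr s)"
proof -
  let ?c = "complex_of_real \<gamma>"
  have "\<exists>r. 0 < r \<and> r \<le> \<delta> \<and> (\<forall>z\<in>ball ?c r - {?c}. f z \<noteq> 0)"
  proof (cases "f ?c = 0")
    case True
    obtain r where r: "0 < r" "ball ?c r \<subseteq> ball ?c \<delta>" "\<And>z. z \<in> ball ?c r - {?c} \<Longrightarrow> f z \<noteq> 0"
      using isolated_zeros[OF f _ _ _ True nz] \<delta> by auto
    then show ?thesis using \<delta> by (intro exI[of _ "min r \<delta>"]) auto
  next
    case False
    have "isCont f ?c" using holomorphic_on_imp_continuous_on[OF f] \<delta> by (simp add: continuous_on_eq_continuous_at)
    then obtain r where "0 < r" "\<And>z. dist z ?c < r \<Longrightarrow> f z \<noteq> 0"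
      using False continuous_at_avoid[of ?c f 0] by (auto simp: dist_commute)
    then show ?thesis using \<delta> by (intro exI[of _ "min r \<delta>"]) (auto simp: dist_commute)
  qed
  then obtain r where r: "0 < r" "r \<le> \<delta>" and fnz: "\<And>z. z \<in> ball ?c r - {?c} \<Longrightarrow> f z \<noteq> 0" by blast
  have D': "D holomorphic_on ball ?c r" and f': "f holomorphic_on ball ?c r"
    using r by (auto intro: holomorphic_on_subset[OF D] holomorphic_on_subset[OF f])
  define H where "H z = D z / f z" for z
  have H: "H holomorphic_on ball ?c r - {?c}"
    unfolding H_def by (intro holomorphic_on_divide holomorphic_on_subset[OF D'] holomorphic_on_subset[OF f']) (use fnz in auto)
  have H_real: "H (complex_of_real s) = complex_of_real (\<integral>x. X x powr s \<partial>M)" if "\<gamma> - r < s" "s < \<gamma>" for s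
  proof -
    have "f (complex_of_real s) \<noteq> 0" using that by (intro fnz) (auto simp: dist_of_real dist_real_def)
    then show ?thesis using eq[of s] that r by (simp add: H_def field_simps)
  qed
  have lim: "((\<lambda>z. (z - ?c) * H z) \<longlongrightarrow> 0) (at ?c)"
  proof (cases "f ?c = 0")
    case False
    have "isCont D ?c" "isCont f ?c"
      using holomorphic_on_imp_continuous_on[OF D] holomorphic_on_imp_continuous_on[OF f] \<delta>
      by (simp_all add: continuous_on_eq_continuous_at)
    then have "isCont (\<lambda>z. (z - ?c) * H z) ?c" unfolding H_def using False by (intro continuous_intros) auto
    then show ?thesis by (simp add: isCont_def)
  next
    case True
    have "(\<lambda>z. (z - ?c) * D z) holomorphic_on ball ?c r" by (intro holomorphic_intros D')
    then have "(\<lambda>z. (z - ?c) * D z) analytic_on {?c}" "f analytic_on {?c}"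
      using f' r by (auto simp: analytic_at intro!: exI[of _ "ball ?c r"])
    then have "not_essential (\<lambda>z. (z - ?c) * D z / f z) ?c"
      by (intro not_essential_divide not_essential_analytic isolated_singularity_at_analytic)
    then have ne: "not_essential (\<lambda>z. (z - ?c) * H z) ?c" by (simp add: H_def)
    have emb: "filterlim complex_of_real (at ?c) (at_left \<gamma>)"
      unfolding filterlim_at
      by (intro conjI tendsto_of_real tendsto_ident_at)
         (auto simp: eventually_at_filter)
    have rl: "((\<lambda>s. (complex_of_real s - ?c) * H (complex_of_real s)) \<longlongrightarrow> 0) (at_left \<gamma>)"
    proof (rule Lim_transform_eventually)
      have "((\<lambda>s. complex_of_real (- ((\<gamma> - s) * (\<integral>x. X x powr s \<partial>M)))) \<longlongrightarrow> complex_of_real (- 0)) (at_left \<gamma>)"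
        by (intro tendsto_of_real tendsto_minus pole True)
      then show "((\<lambda>s. complex_of_real (- ((\<gamma> - s) * (\<integral>x. X x powr s \<partial>M)))) \<longlongrightarrow> 0) (at_left \<gamma>)" by simp
      have "eventually (\<lambda>s. s \<in> {\<gamma> - r<..<\<gamma>}) (at_left \<gamma>)"
        using r by (intro eventually_at_leftI[of "\<gamma> - r"]) auto
      then show "\<forall>\<^sub>F s in at_left \<gamma>. complex_of_real (- ((\<gamma> - s) * (\<integral>x. X x powr s \<partial>M))) =
          (complex_of_real s - ?c) * H (complex_of_real s)"
        by eventually_elim (simp add: H_real algebra_simps)
    qed
    \<comment> \<open>The limit along the reals forces the complex limit to be \<open>0\<close> and rules out a pole.\<close>
    from ne consider l where "((\<lambda>z. (z - ?c) * H z) \<longlongrightarrow> l) (at ?c)" | "is_pole (\<lambda>z. (z - ?c) * H z) ?c"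
      unfolding not_essential_def by blast
    then show ?thesis
    proof cases
      case 1
      from filterlim_compose[OF this emb] rl have "l = 0"
        by (rule tendsto_unique[rotated]) simp
      with 1 show ?thesis by simp
    next
      case 2
      from filterlim_compose[OF this[unfolded is_pole_def] emb] rl show ?thesis
        using not_tendsto_and_filterlim_at_infinity[OF trivial_limit_at_left_real] by blast
    qed
  qed
  have "?c \<in> interior (ball ?c r)" using r by simp
  from holomorphic_on_extend_lim[OF H this] lim
  obtain g where g: "g holomorphic_on ball ?c r" "\<And>z. z \<in> ball ?c r - {?c} \<Longrightarrow> g z = H z" by blast
  show ?thesis
  proof (rule landau_moment[OF assms(1-3) r(1) _ g(1)])
    show "r \<le> \<gamma>" using r \<delta> by simp
    fix s assume s: "\<gamma> - r < s" "s < \<gamma>"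
    show "integrable M (\<lambda>x. X x powr s)" using s r by (intro int) auto
    have "complex_of_real s \<in> ball ?c r - {?c}" using s by (auto simp: dist_of_real dist_real_def)
    then show "g (complex_of_real s) = complex_of_real (\<integral>x. X x powr s \<partial>M)"
      using g(2) H_real[OF s] by simp
  qed
qed

text \<open>An Abelian argument: \<open>E X\<^sup>s = s \<integral> e\<^sup>s\<^sup>v P(X > e\<^sup>v) dv\<close>, and if the tail is eventually below \<open>\<eta> e\<^sup>-\<^sup>\<beta>\<^sup>v\<close>, the
  integral is bounded by a constant plus \<open>\<eta> / (\<beta> - s)\<close>, with \<open>\<eta>\<close> arbitrarily small.\<close>
lemma moment_at_critical_exponent:
  fixes X :: "'a \<Rightarrow> real"
  assumes "prob_space M" and [measurable]: "X \<in> borel_measurable M" and X0: "\<And>x. 0 \<le> X x" and \<beta>: "0 < \<beta>"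
    and tail: "((\<lambda>t. t powr \<beta> * measure M {x \<in> space M. X x > t}) \<longlongrightarrow> 0) at_top"
  shows "((\<lambda>s. (\<beta> - s) * (\<integral>x. X x powr s \<partial>M)) \<longlongrightarrow> 0) (at_left \<beta>)"
proof -
  interpret prob_space M by fact
  have sfM: "sigma_finite_measure M" by (rule sigma_finite_measure_axioms)
  interpret pair_sigma_finite M lborel ..
  have bound: "\<exists>T. \<forall>s. 0 < s \<longrightarrow> s < \<beta> \<longrightarrow> (\<beta> - s) * (\<integral>x. X x powr s \<partial>M) \<le> (\<beta> - s) * exp (\<beta> * T) + \<beta> * \<eta>"
    if \<eta>: "0 < \<eta>" for \<eta>
  proof -
    from order_tendstoD(2)[OF tail \<eta>] obtain T0 where T0: "\<And>t. t \<ge> T0 \<Longrightarrow> t powr \<beta> * prob {x \<in> space M. X x > t} < \<eta>"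
      by (auto simp: eventually_at_top_linorder)
    define T where "T = ln (max 1 T0)"
    have T: "0 \<le> T" "\<And>v. v \<ge> T \<Longrightarrow> T0 \<le> exp v"
      by (auto simp: T_def ln_ge_iff split: if_splits) (metis exp_le_cancel_iff exp_ln less_max_iff_disj max.bounded_iff zero_less_one)
    have tl: "prob {x \<in> space M. X x > exp v} \<le> \<eta> * exp (- (\<beta> * v))" if "v \<ge> T" for v
      using T0[OF T(2)[OF that]] by (simp add: powr_def exp_minus field_simps)
    have main: "(\<integral>x. X x powr s \<partial>M) \<le> exp (s * T) + s * \<eta> / (\<beta> - s)" if s: "0 < s" "s < \<beta>" for s
    proof -
      have "(\<integral>\<^sup>+x. ennreal (X x powr s / s) \<partial>M) =
          (\<integral>\<^sup>+p. ennreal (below (X (fst p)) (snd p) * exp (s * snd p)) \<partial>(M \<Otimes>\<^sub>M lborel))"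
        by (rule nn_integral_below_pair[symmetric]) (simp_all add: X0 s sfM)
      also have "\<dots> = (\<integral>\<^sup>+v. \<integral>\<^sup>+x. ennreal (below (X x) v * exp (s * v)) \<partial>M \<partial>lborel)"
        by (subst nn_integral_snd[symmetric]) simp_all
      also have "\<dots> = (\<integral>\<^sup>+v. ennreal (exp (s * v) * prob {x \<in> space M. X x > exp v}) \<partial>lborel)"
      proof (rule nn_integral_cong)
        fix v :: real
        have "(\<integral>\<^sup>+x. ennreal (below (X x) v * exp (s * v)) \<partial>M) =
              (\<integral>\<^sup>+x. ennreal (exp (s * v)) * indicator {x \<in> space M. X x > exp v} x \<partial>M)"
          by (intro nn_integral_cong) (auto simp: below_def)
        then show "(\<integral>\<^sup>+x. ennreal (below (X x) v * exp (s * v)) \<partial>M) = ennreal (exp (s * v) * prob {x \<in> space M. X x > exp v})"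
          by (simp add: nn_integral_cmult emeasure_eq_measure ennreal_mult)
      qed
      also have "\<dots> \<le> (\<integral>\<^sup>+v. ennreal (below (exp T) v * exp (s * v)) + ennreal (\<eta> * exp (- ((\<beta> - s) * v))) * indicator {T..} v \<partial>lborel)"
      proof (rule nn_integral_mono)
        fix v :: real
        show "ennreal (exp (s * v) * prob {x \<in> space M. X x > exp v}) \<le>
           ennreal (below (exp T) v * exp (s * v)) + ennreal (\<eta> * exp (- ((\<beta> - s) * v))) * indicator {T..} v"
        proof (cases "v < T")
          case True
          then show ?thesis by (simp add: below_def mult_left_le)
        next
          case False
          have "exp (s * v) * prob {x \<in> space M. X x > exp v} \<le> exp (s * v) * (\<eta> * exp (- (\<beta> * v)))"
            using tl False by (intro mult_left_mono) auto
          also have "\<dots> = \<eta> * exp (- ((\<beta> - s) * v))" by (simp add: exp_add[symmetric] algebra_simps exp_diff exp_minus divide_inverse)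
          finally show ?thesis using False by (simp add: below_def ennreal_leI)
        qed
      qed
      also have "\<dots> = ennreal (exp T powr s / s) + (\<integral>\<^sup>+v. ennreal (\<eta> * exp (- ((\<beta> - s) * v))) * indicator {T..} v \<partial>lborel)"
        using s by (subst nn_integral_add) (auto simp: nn_integral_below)
      also have "(\<integral>\<^sup>+v. ennreal (\<eta> * exp (- ((\<beta> - s) * v))) * indicator {T..} v \<partial>lborel) =
          ennreal (0 - (- \<eta> * exp (- ((\<beta> - s) * T)) / (\<beta> - s)))"
      proof (rule nn_integral_FTC_atLeast)
        show "DERIV (\<lambda>v. - \<eta> * exp (- ((\<beta> - s) * v)) / (\<beta> - s)) x :> \<eta> * exp (- ((\<beta> - s) * x))" for x
        proof -
          have "DERIV (\<lambda>v. - \<eta> * exp (- (c * v)) / c) x :> \<eta> * exp (- (c * x))" if "c \<noteq> 0" for c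
            using that by (auto intro!: derivative_eq_intros)
          from this[of "\<beta> - s"] s show ?thesis by simp
        qed
        have "LIM v at_top. (\<beta> - s) * v :> at_top"
          using s by (intro filterlim_tendsto_pos_mult_at_top[OF tendsto_const _ filterlim_ident]) auto
        then have "LIM v at_top. - ((\<beta> - s) * v) :> at_bot" by (simp add: filterlim_uminus_at_top)
        then have "((\<lambda>v. exp (- ((\<beta> - s) * v))) \<longlongrightarrow> 0) at_top" by (rule filterlim_compose[OF exp_at_bot])
        then have "((\<lambda>v. - \<eta> * exp (- ((\<beta> - s) * v)) / (\<beta> - s)) \<longlongrightarrow> - \<eta> * 0 / (\<beta> - s)) at_top"
          by (intro tendsto_intros) (use s in auto)
        then show "((\<lambda>v. - \<eta> * exp (- ((\<beta> - s) * v)) / (\<beta> - s)) \<longlongrightarrow> 0) at_top" by simp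
      qed (use \<eta> in auto)
      also have "ennreal (exp T powr s / s) + ennreal (0 - (- \<eta> * exp (- ((\<beta> - s) * T)) / (\<beta> - s))) =
          ennreal (exp (s * T) / s + \<eta> * exp (- ((\<beta> - s) * T)) / (\<beta> - s))"
        using s \<eta> by (subst ennreal_plus[symmetric]) (auto simp: powr_def)
      also have "\<dots> \<le> ennreal (exp (s * T) / s + \<eta> / (\<beta> - s))"
        using s \<eta> T by (intro ennreal_leI add_left_mono divide_right_mono) (auto simp: mult_left_le)
      finally have le: "(\<integral>\<^sup>+x. ennreal (X x powr s / s) \<partial>M) \<le> ennreal (exp (s * T) / s + \<eta> / (\<beta> - s))" .
      have "(\<integral>x. X x powr s / s \<partial>M) \<le> exp (s * T) / s + \<eta> / (\<beta> - s)"
        using s \<eta> by (intro integral_real_bounded le) auto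
      then have "(\<integral>x. X x powr s \<partial>M) \<le> s * (exp (s * T) / s + \<eta> / (\<beta> - s))"
        using s by (simp add: field_simps)
      then show ?thesis using s by (simp add: distrib_left)
    qed
    show ?thesis
    proof (intro exI[of _ T] allI impI)
      fix s assume s: "0 < s" "s < \<beta>"
      have "(\<beta> - s) * (\<integral>x. X x powr s \<partial>M) \<le> (\<beta> - s) * (exp (s * T) + s * \<eta> / (\<beta> - s))"
        using s by (intro mult_left_mono main) auto
      also have "\<dots> = (\<beta> - s) * exp (s * T) + s * \<eta>" using s by (simp add: field_simps)
      also have "\<dots> \<le> (\<beta> - s) * exp (\<beta> * T) + \<beta> * \<eta>"
        using s \<eta> T by (intro add_mono mult_left_mono mult_right_mono) (auto intro: mult_right_mono)
      finally show "(\<beta> - s) * (\<integral>x. X x powr s \<partial>M) \<le> (\<beta> - s) * exp (\<beta> * T) + \<beta> * \<eta>" .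
    qed
  qed
  show ?thesis
  proof (rule tendstoI)
    fix e :: real assume e: "0 < e"
    define \<eta> where "\<eta> = e / (2 * \<beta>)"
    have \<eta>: "0 < \<eta>" "\<beta> * \<eta> = e / 2" using e \<beta> by (auto simp: \<eta>_def)
    from bound[OF \<eta>(1)] obtain T where
      T: "\<And>s. 0 < s \<Longrightarrow> s < \<beta> \<Longrightarrow> (\<beta> - s) * (\<integral>x. X x powr s \<partial>M) \<le> (\<beta> - s) * exp (\<beta> * T) + \<beta> * \<eta>" by blast
    have "((\<lambda>s. (\<beta> - s) * exp (\<beta> * T) + \<beta> * \<eta>) \<longlongrightarrow> (\<beta> - \<beta>) * exp (\<beta> * T) + \<beta> * \<eta>) (at_left \<beta>)"
      by (intro tendsto_intros)
    then have "eventually (\<lambda>s. (\<beta> - s) * exp (\<beta> * T) + \<beta> * \<eta> < e) (at_left \<beta>)"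
      by (rule order_tendstoD) (use e \<eta> in simp)
    moreover have "eventually (\<lambda>s. s \<in> {0<..<\<beta>}) (at_left \<beta>)"
      using \<beta> by (intro eventually_at_leftI[of 0]) auto
    ultimately show "\<forall>\<^sub>F s in at_left \<beta>. dist ((\<beta> - s) * (\<integral>x. X x powr s \<partial>M)) 0 < e"
    proof eventually_elim
      case (elim s)
      then have "0 \<le> (\<beta> - s) * (\<integral>x. X x powr s \<partial>M)" by simp
      with elim T[of s] show ?case by (simp add: dist_real_def)
    qed
  qed
qed

text \<open>The convention \<open>0 powr s = 0\<close> lets the indicator of \<open>0 < X\<close> absorb the points where \<open>ln (X x)\<close> is a
  default value.\<close>
lemma holomorphic_power_moment:
  fixes X :: "'a \<Rightarrow> real"
  assumes [measurable]: "X \<in> borel_measurable M" and X0: "\<And>x. x \<in> space M \<Longrightarrow> 0 \<le> X x"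
    and ia: "integrable M (\<lambda>x. X x powr a)" and ib: "integrable M (\<lambda>x. X x powr b)"
  shows "\<exists>F. F holomorphic_on {z. a < Re z \<and> Re z < b} \<and>
             (\<forall>s. F (complex_of_real s) = complex_of_real (\<integral>x. X x powr s \<partial>M))"
proof -
  define h where "h x = (if 0 < X x then 1 else 0 :: real)" for x
  define u where "u x = ln (X x)" for x
  have [measurable]: "h \<in> borel_measurable M" "u \<in> borel_measurable M" unfolding h_def u_def by measurable
  have eq: "X x powr s = h x * exp (s * u x)" if "x \<in> space M" for x s
    using X0[OF that] by (auto simp: h_def u_def powr_def)
  define F where "F z = (\<integral>x. complex_of_real (h x) * exp (z * complex_of_real (u x)) \<partial>M)" for z
  have "integrable M (\<lambda>x. h x * exp (a * u x))" "integrable M (\<lambda>x. h x * exp (b * u x))"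
    using ia ib eq by (simp_all cong: Bochner_Integration.integrable_cong)
  then have "F holomorphic_on {z. a < Re z \<and> Re z < b}"
    unfolding F_def by (intro holomorphic_exp_moment) auto
  moreover have "F (complex_of_real s) = complex_of_real (\<integral>x. X x powr s \<partial>M)" for s
  proof -
    have "F (complex_of_real s) = (\<integral>x. complex_of_real (X x powr s) \<partial>M)"
      unfolding F_def by (intro Bochner_Integration.integral_cong) (simp_all add: eq exp_of_real[symmetric])
    then show ?thesis by (simp only: integral_complex_of_real)
  qed
  ultimately show ?thesis by blast
qed

text \<open>The formula for \<open>D\<close> holds only where all the moments exist separately, but \<open>D\<close> itself is an absolutely
  convergent exponential moment over \<open>M \<Otimes>\<^sub>M lborel\<close> on the whole strip. This is how the difference of two
  moments is continued past the point where each of them may be infinite.\<close>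
lemma holomorphic_defect:
  fixes Y :: "'i \<Rightarrow> 'a \<Rightarrow> 'v::{real_normed_vector, second_countable_topology}"
  assumes "prob_space M" and fin: "finite I" and ne: "I \<noteq> {}"
    and [measurable]: "\<And>i. i \<in> I \<Longrightarrow> Y i \<in> borel_measurable M"
    and e: "0 < e" "e \<le> 1" "e \<le> a" "a \<le> b"
    and mix: "\<And>s i l. s \<in> {a, b} \<Longrightarrow> i \<in> I \<Longrightarrow> l \<in> I \<Longrightarrow> i \<noteq> l \<Longrightarrow>
        integrable M (\<lambda>x. norm (Y i x) powr e * norm (Y l x) powr (s - e))"
  shows "\<exists>D. D holomorphic_on {z. a < Re z \<and> Re z < b} \<and>
     (\<forall>s>0. integrable M (\<lambda>x. norm (\<Sum>i\<in>I. Y i x) powr s) \<longrightarrow>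
        (\<forall>i\<in>I. integrable M (\<lambda>x. norm (Y i x) powr s)) \<longrightarrow>
        D (complex_of_real s) =
          complex_of_real (((\<integral>x. norm (\<Sum>i\<in>I. Y i x) powr s \<partial>M) - (\<Sum>i\<in>I. \<integral>x. norm (Y i x) powr s \<partial>M)) / s))"
proof -
  interpret prob_space M by fact
  have sfM: "sigma_finite_measure M" by (rule sigma_finite_measure_axioms)
  interpret pair_sigma_finite M lborel ..
  define k where "k p = below (norm (\<Sum>i\<in>I. Y i (fst p))) (snd p) - (\<Sum>i\<in>I. below (norm (Y i (fst p))) (snd p))" for p
  have [measurable]: "k \<in> borel_measurable (M \<Otimes>\<^sub>M lborel)"
    unfolding k_def by measurable
  have int: "integrable (M \<Otimes>\<^sub>M lborel) (\<lambda>p. k p * exp (s * snd p))" if s: "s \<in> {a, b}" for s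
  proof (rule integrableI_bounded)
    have s': "e \<le> s" using s e by auto
    define c where "c = (2 + s * real (card I) powr s) / s"
    define G where "G x = (\<Sum>l\<in>I. \<Sum>i\<in>I-{l}. norm (Y i x) powr e * norm (Y l x) powr (s - e))" for x
    have "integrable M G" unfolding G_def using s by (intro Bochner_Integration.integrable_sum mix) auto
    then have iG: "integrable M (\<lambda>x. c * G x)" by simp
    have "0 \<le> c" using s' e by (auto simp: c_def)
    then have cG: "0 \<le> c * G x" for x by (auto simp: G_def intro!: mult_nonneg_nonneg sum_nonneg)
    have "(\<integral>\<^sup>+p. ennreal (norm (k p * exp (s * snd p))) \<partial>(M \<Otimes>\<^sub>M lborel)) =
          (\<integral>\<^sup>+x. \<integral>\<^sup>+v. ennreal \<bar>k (x, v) * exp (s * v)\<bar> \<partial>lborel \<partial>M)"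
      by (subst lborel.nn_integral_fst[symmetric]) simp_all
    also have "\<dots> \<le> (\<integral>\<^sup>+x. ennreal (c * G x) \<partial>M)"
      using nn_integral_tail_defect_le[OF fin ne e(1,2) s']
      by (intro nn_integral_mono) (simp add: k_def c_def G_def)
    also have "\<dots> < \<infinity>"
      using nn_integral_eq_integral[OF iG] cG by simp
    finally show "(\<integral>\<^sup>+p. ennreal (norm (k p * exp (s * snd p))) \<partial>(M \<Otimes>\<^sub>M lborel)) < \<infinity>" .
  qed measurable
  define D where "D z = (\<integral>p. complex_of_real (k p) * exp (z * complex_of_real (snd p)) \<partial>(M \<Otimes>\<^sub>M lborel))" for z
  have "D holomorphic_on {z. a < Re z \<and> Re z < b}"
    unfolding D_def by (intro holomorphic_exp_moment int) auto
  moreover have "D (complex_of_real s) =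
          complex_of_real (((\<integral>x. norm (\<Sum>i\<in>I. Y i x) powr s \<partial>M) - (\<Sum>i\<in>I. \<integral>x. norm (Y i x) powr s \<partial>M)) / s)"
    if s: "0 < s" and W: "integrable M (\<lambda>x. norm (\<Sum>i\<in>I. Y i x) powr s)"
      and Yi: "\<forall>i\<in>I. integrable M (\<lambda>x. norm (Y i x) powr s)" for s
  proof -
    have "has_bochner_integral (M \<Otimes>\<^sub>M lborel)
      (\<lambda>p. below (norm (\<Sum>i\<in>I. Y i (fst p))) (snd p) * exp (s * snd p) - (\<Sum>i\<in>I. below (norm (Y i (fst p))) (snd p) * exp (s * snd p)))
      ((\<integral>x. norm (\<Sum>i\<in>I. Y i x) powr s \<partial>M) / s - (\<Sum>i\<in>I. (\<integral>x. norm (Y i x) powr s \<partial>M) / s))"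
      using Yi by (intro has_bochner_integral_diff has_bochner_integral_sum has_integral_below_pair sfM s W) auto
    then have "(\<integral>p. k p * exp (s * snd p) \<partial>(M \<Otimes>\<^sub>M lborel)) =
        (\<integral>x. norm (\<Sum>i\<in>I. Y i x) powr s \<partial>M) / s - (\<Sum>i\<in>I. (\<integral>x. norm (Y i x) powr s \<partial>M) / s)"
      by (simp add: has_bochner_integral_iff k_def left_diff_distrib sum_distrib_right)
    moreover have "D (complex_of_real s) = (\<integral>p. complex_of_real (k p * exp (s * snd p)) \<partial>(M \<Otimes>\<^sub>M lborel))"
      by (simp add: D_def exp_of_real[symmetric])
    then have "D (complex_of_real s) = complex_of_real (\<integral>p. k p * exp (s * snd p) \<partial>(M \<Otimes>\<^sub>M lborel))"
      by (simp only: integral_complex_of_real)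
    ultimately show ?thesis by (simp add: sum_divide_distrib diff_divide_distrib)
  qed
  ultimately show ?thesis by blast
qed

section \<open>Measurability and products\<close>
lemma continuous_on_opnorm: "continuous_on UNIV (opnorm :: real ^ 'n ^ 'm \<Rightarrow> real)"
proof -
  have lip: "\<bar>opnorm A - opnorm B\<bar> \<le> real CARD('m) * real CARD('n) * dist A B" for A B :: "real ^ 'n ^ 'm"
  proof -
    have tri: "opnorm A \<le> opnorm B + opnorm (A - B)" for A B :: "real ^ 'n ^ 'm"
      using onorm_triangle[of "(*v) B" "(*v) (A - B)"]
      by (simp add: matrix_vector_mul_bounded_linear flip: matrix_vector_mult_add_rdistrib)
    have le: "opnorm (A - B) \<le> real CARD('m) * real CARD('n) * dist A B" for A B :: "real ^ 'n ^ 'm"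
    proof (rule onorm_le_matrix_component)
      fix i j
      have "\<bar>(A - B) $ i $ j\<bar> \<le> norm ((A - B) $ i)" by (rule component_le_norm_cart)
      also have "\<dots> \<le> norm (A - B)" by (rule Finite_Cartesian_Product.norm_nth_le)
      finally show "\<bar>(A - B) $ i $ j\<bar> \<le> dist A B" by (simp add: dist_norm)
    qed
    show ?thesis
      using tri[of A B] tri[of B A] le[of A B] le[of B A] unfolding dist_commute[of B A] by linarith
  qed
  show ?thesis
    by (rule lipschitz_on_continuous_on[OF lipschitz_onI[where L="real CARD('m) * real CARD('n)"]]) (simp_all add: dist_real_def lip)
qed

lemma borel_measurable_opnorm [measurable]: "opnorm \<in> borel_measurable borel"
  by (rule borel_measurable_continuous_onI) (rule continuous_on_opnorm)

lemma borel_measurable_matrix_vector_mult [measurable (raw)]: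
  fixes f :: "'a \<Rightarrow> real ^ 'n ^ 'm"
  assumes f: "f \<in> borel_measurable M" and g: "g \<in> borel_measurable M"
  shows "(\<lambda>x. f x *v g x) \<in> borel_measurable M"
proof -
  have "continuous_on UNIV (\<lambda>p::(real ^ 'n ^ 'm) \<times> (real ^ 'n). fst p *v snd p)"
    unfolding matrix_vector_mult_def by (intro continuous_intros continuous_on_vec_lambda)
  from borel_measurable_continuous_Pair[OF f g, of "\<lambda>a b. a *v b"] this
  show ?thesis by simp
qed

lemma nn_integral_PiM_two:
  assumes "prob_space \<rho>" and fin: "finite I" and il: "i \<in> I" "l \<in> I" "i \<noteq> l"
    and [measurable]: "f \<in> borel_measurable \<rho>" "g \<in> borel_measurable \<rho>"
  shows "(\<integral>\<^sup>+x. f (x i) * g (x l) \<partial>(\<Pi>\<^sub>M i\<in>I. \<rho>)) = (\<integral>\<^sup>+x. f x \<partial>\<rho>) * (\<integral>\<^sup>+x. g x \<partial>\<rho>)"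
proof -
  interpret prob_space \<rho> by fact
  have sp: "emeasure \<rho> (space \<rho>) = 1" by (rule emeasure_space_1)
  interpret product_prob_space "\<lambda>_. \<rho>" I ..
  define h where "h k = (if k = i then f else if k = l then g else (\<lambda>_. 1))" for k
  have split: "(\<Prod>k\<in>I. F k) = F i * F l" if "\<And>k. k \<noteq> i \<Longrightarrow> k \<noteq> l \<Longrightarrow> F k = 1" for F :: "_ \<Rightarrow> ennreal"
  proof -
    have "(\<Prod>k\<in>I. F k) = (\<Prod>k\<in>{i, l}. F k)" using il fin that by (intro prod.mono_neutral_right) auto
    then show ?thesis using il by simp
  qed
  have "(\<integral>\<^sup>+x. f (x i) * g (x l) \<partial>(\<Pi>\<^sub>M i\<in>I. \<rho>)) = (\<integral>\<^sup>+x. (\<Prod>k\<in>I. h k (x k)) \<partial>(\<Pi>\<^sub>M i\<in>I. \<rho>))"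
    using il by (subst split) (auto simp: h_def)
  also have "\<dots> = (\<Prod>k\<in>I. \<integral>\<^sup>+x. h k x \<partial>\<rho>)"
    by (rule product_nn_integral_prod[OF fin]) (auto simp: h_def)
  also have "\<dots> = (\<integral>\<^sup>+x. f x \<partial>\<rho>) * (\<integral>\<^sup>+x. g x \<partial>\<rho>)"
    using il by (subst split) (auto simp: h_def sp)
  finally show ?thesis .
qed

lemma nn_integral_pair_mult:
  assumes "sigma_finite_measure N" and [measurable]: "f \<in> borel_measurable M" "g \<in> borel_measurable N"
  shows "(\<integral>\<^sup>+p. f (fst p) * g (snd p) \<partial>(M \<Otimes>\<^sub>M N)) = (\<integral>\<^sup>+x. f x \<partial>M) * (\<integral>\<^sup>+y. g y \<partial>N)"
proof -
  interpret sigma_finite_measure N by fact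
  have "(\<integral>\<^sup>+p. f (fst p) * g (snd p) \<partial>(M \<Otimes>\<^sub>M N)) = (\<integral>\<^sup>+x. \<integral>\<^sup>+y. f x * g y \<partial>N \<partial>M)"
    by (subst nn_integral_fst[symmetric]) simp_all
  also have "\<dots> = (\<integral>\<^sup>+x. f x \<partial>M) * (\<integral>\<^sup>+y. g y \<partial>N)"
    by (simp add: nn_integral_cmult nn_integral_multc)
  finally show ?thesis .
qed

lemma opnorm_nonneg: "0 \<le> opnorm (A :: real ^ 'n ^ 'm)"
  by (intro onorm_pos_le matrix_vector_mul_bounded_linear)
lemma powr_mult_le_add_powr:
  fixes a b :: real
  assumes "0 \<le> a" "0 \<le> b" "0 \<le> e" "e \<le> s"
  shows "a powr e * b powr (s - e) \<le> a powr s + b powr s"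
proof -
  have "a powr e * b powr (s - e) \<le> max a b powr e * max a b powr (s - e)"
    using assms by (intro mult_mono powr_mono2) auto
  also have "\<dots> = max a b powr s" by (simp flip: powr_add)
  also have "\<dots> \<le> a powr s + b powr s" by (auto simp: max_def)
  finally show ?thesis .
qed

section \<open>Solutions of the smoothing equation\<close>
locale smoothing_fixed_point = prob_space M
  for M :: "'a measure" +
  fixes N :: nat and C :: "nat \<Rightarrow> 'a \<Rightarrow> real ^ 'n ^ 'n" and Q :: "'a \<Rightarrow> real ^ 'n"
    and P :: "'b measure" and R :: "'b \<Rightarrow> real ^ 'n"
  assumes C_meas: "\<And>i. i \<in> {1..N} \<Longrightarrow> C i \<in> borel_measurable M"
    and C_sim: "\<And>i \<omega>. i \<in> {1..N} \<Longrightarrow> \<omega> \<in> space M \<Longrightarrow> C i \<omega> \<in> similarities"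
    and Q_meas [measurable]: "Q \<in> borel_measurable M"
    and solution: "is_solution M N C Q P R"
begin

text \<open>\<open>copies\<close> and \<open>joint\<close> are the product spaces underlying the smoothing transform, so that under \<open>joint\<close>
  the sum of all summands has the law of \<open>R\<close>.\<close>
definition copies :: "(nat \<Rightarrow> real ^ 'n) measure" where
  "copies = (\<Pi>\<^sub>M i\<in>{1..N}. distr P borel R)"

definition joint :: "('a \<times> (nat \<Rightarrow> real ^ 'n)) measure" where
  "joint = M \<Otimes>\<^sub>M copies"

text \<open>Index \<open>0\<close> is free for the inhomogeneous term, so that the whole right-hand side is one sum.\<close>

definition summand :: "nat \<Rightarrow> 'a \<times> (nat \<Rightarrow> real ^ 'n) \<Rightarrow> real ^ 'n" where
  "summand i p = (if i = 0 then Q (fst p) else C i (fst p) *v snd p i)"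

lemma prob_P: "prob_space P" and R_meas [measurable]: "R \<in> borel_measurable P"
  using solution by (auto simp: is_solution_def)

lemma prob_law: "prob_space (distr P borel R)"
  using prob_P R_meas by (rule prob_space.prob_space_distr)

lemma prob_copies: "prob_space copies"
  unfolding copies_def by (intro prob_space_PiM prob_law)

lemma prob_joint: "prob_space joint"
proof -
  interpret L: prob_space copies by (rule prob_copies)
  interpret pair_prob_space M copies ..
  show ?thesis unfolding joint_def by (rule prob_space_axioms)
qed

lemma norm_C_mult: "i \<in> {1..N} \<Longrightarrow> \<omega> \<in> space M \<Longrightarrow> norm (C i \<omega> *v x) = opnorm (C i \<omega>) * norm x"
  using C_sim by (auto simp: similarities_def)

lemma opnorm_C_meas [measurable]: "i \<in> {1..N} \<Longrightarrow> (\<lambda>\<omega>. opnorm (C i \<omega>)) \<in> borel_measurable M"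
  by (rule measurable_compose[OF C_meas borel_measurable_opnorm])

lemma coordinate_meas: "i \<in> {1..N} \<Longrightarrow> (\<lambda>x. x i) \<in> measurable copies borel"
  using measurable_component_singleton[of i "{1..N}" "\<lambda>_. distr P borel R"] by (simp add: copies_def)

lemma summand_meas [measurable]:
  assumes "i \<in> {0..N}"
  shows "summand i \<in> borel_measurable joint"
proof (cases "i = 0")
  case True
  then show ?thesis by (simp add: summand_def[abs_def] joint_def)
next
  case False
  then have i: "i \<in> {1..N}" using assms by simp
  note [measurable] = C_meas[OF i] coordinate_meas[OF i]
  show ?thesis using False by (simp add: summand_def[abs_def] joint_def)
qed

lemma sum_summand: "(\<Sum>i\<in>{0..N}. summand i p) = (\<Sum>i=1..N. C i (fst p) *v snd p i) + Q (fst p)"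
proof -
  have "(\<Sum>i\<in>{0..N}. summand i p) = summand 0 p + (\<Sum>i\<in>{1..N}. summand i p)"
    by (subst sum.atLeast_Suc_atMost) auto
  also have "(\<Sum>i\<in>{1..N}. summand i p) = (\<Sum>i=1..N. C i (fst p) *v snd p i)"
    by (intro sum.cong) (auto simp: summand_def)
  finally show ?thesis by (simp add: summand_def)
qed

lemma nn_integral_sum_summand:
  assumes [measurable]: "g \<in> borel_measurable borel"
  shows "(\<integral>\<^sup>+p. g (\<Sum>i\<in>{0..N}. summand i p) \<partial>joint) = (\<integral>\<^sup>+\<omega>. g (R \<omega>) \<partial>P)"
proof -
  have m: "(\<lambda>p. \<Sum>i\<in>{0..N}. summand i p) \<in> borel_measurable joint" by measurable
  have "distr joint borel (\<lambda>p. \<Sum>i\<in>{0..N}. summand i p) = smoothing_transform M N C Q (distr P borel R)"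
    unfolding smoothing_transform_def joint_def copies_def sum_summand by (simp add: case_prod_beta')
  also have "\<dots> = distr P borel R" using solution by (simp add: is_solution_def)
  finally have eq: "distr joint borel (\<lambda>p. \<Sum>i\<in>{0..N}. summand i p) = distr P borel R" .
  have "(\<integral>\<^sup>+p. g (\<Sum>i\<in>{0..N}. summand i p) \<partial>joint) = (\<integral>\<^sup>+y. g y \<partial>distr joint borel (\<lambda>p. \<Sum>i\<in>{0..N}. summand i p))"
    by (rule nn_integral_distr[symmetric]) (use m in auto)
  also have "\<dots> = (\<integral>\<^sup>+\<omega>. g (R \<omega>) \<partial>P)" unfolding eq by (rule nn_integral_distr) auto
  finally show ?thesis .
qed

lemma nn_integral_coordinate:
  assumes i: "i \<in> {1..N}" and [measurable]: "f \<in> borel_measurable M" "g \<in> borel_measurable borel"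
  shows "(\<integral>\<^sup>+p. f (fst p) * g (snd p i) \<partial>joint) = (\<integral>\<^sup>+\<omega>. f \<omega> \<partial>M) * (\<integral>\<^sup>+\<omega>. g (R \<omega>) \<partial>P)"
proof -
  have [measurable]: "(\<lambda>x. x i) \<in> measurable copies borel" by (rule coordinate_meas[OF i])
  have "(\<integral>\<^sup>+p. f (fst p) * g (snd p i) \<partial>joint) = (\<integral>\<^sup>+\<omega>. f \<omega> \<partial>M) * (\<integral>\<^sup>+x. g (x i) \<partial>copies)"
    unfolding joint_def
    by (rule nn_integral_pair_mult[where g = "\<lambda>x. g (x i)"])
       (auto intro: prob_space_imp_sigma_finite prob_copies)
  also have "(\<integral>\<^sup>+x. g (x i) \<partial>copies) =
      (\<integral>\<^sup>+y. g y \<partial>distr copies (distr P borel R) (\<lambda>x. x i))"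
    by (rule nn_integral_distr[symmetric]) (use coordinate_meas[OF i] in simp_all)
  also have "\<dots> = (\<integral>\<^sup>+y. g y \<partial>distr P borel R)"
    unfolding copies_def by (subst distr_PiM_component) (use i prob_law in \<open>simp_all del: One_nat_def\<close>)
  also have "\<dots> = (\<integral>\<^sup>+\<omega>. g (R \<omega>) \<partial>P)" by (rule nn_integral_distr) auto
  finally show ?thesis .
qed

lemma nn_integral_two_coordinates:
  assumes il: "i \<in> {1..N}" "l \<in> {1..N}" "i \<noteq> l"
    and [measurable]: "f \<in> borel_measurable M" "g \<in> borel_measurable borel" "h \<in> borel_measurable borel"
  shows "(\<integral>\<^sup>+p. f (fst p) * (g (snd p i) * h (snd p l)) \<partial>joint) =
           (\<integral>\<^sup>+\<omega>. f \<omega> \<partial>M) * ((\<integral>\<^sup>+\<omega>. g (R \<omega>) \<partial>P) * (\<integral>\<^sup>+\<omega>. h (R \<omega>) \<partial>P))"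
proof -
  note [measurable] = coordinate_meas[OF il(1)] coordinate_meas[OF il(2)]
  have "(\<integral>\<^sup>+p. f (fst p) * (g (snd p i) * h (snd p l)) \<partial>joint) =
      (\<integral>\<^sup>+\<omega>. f \<omega> \<partial>M) * (\<integral>\<^sup>+x. g (x i) * h (x l) \<partial>copies)"
    unfolding joint_def
    by (rule nn_integral_pair_mult[where g = "\<lambda>x. g (x i) * h (x l)"])
       (auto intro: prob_space_imp_sigma_finite prob_copies)
  also have "(\<integral>\<^sup>+x. g (x i) * h (x l) \<partial>copies) =
      (\<integral>\<^sup>+y. g y \<partial>distr P borel R) * (\<integral>\<^sup>+y. h y \<partial>distr P borel R)"
    unfolding copies_def by (rule nn_integral_PiM_two[OF prob_law _ il]) auto
  also have "\<dots> = (\<integral>\<^sup>+\<omega>. g (R \<omega>) \<partial>P) * (\<integral>\<^sup>+\<omega>. h (R \<omega>) \<partial>P)"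
    by (simp add: nn_integral_distr)
  finally show ?thesis .
qed

lemma integrable_summand:
  assumes i: "i \<in> {1..N}"
    and c: "integrable M (\<lambda>\<omega>. opnorm (C i \<omega>) powr s)" and R: "integrable P (\<lambda>\<omega>. norm (R \<omega>) powr s)"
  shows "has_bochner_integral joint (\<lambda>p. norm (summand i p) powr s)
           ((\<integral>\<omega>. opnorm (C i \<omega>) powr s \<partial>M) * (\<integral>\<omega>. norm (R \<omega>) powr s \<partial>P))"
proof (rule has_bochner_integral_nn_integral)
  have "norm (summand i p) powr s = opnorm (C i (fst p)) powr s * norm (snd p i) powr s" if "p \<in> space joint" for p
    using that i norm_C_mult[OF i, of "fst p" "snd p i"]
    by (auto simp: summand_def joint_def space_pair_measure powr_mult opnorm_nonneg)
  then have "(\<integral>\<^sup>+p. ennreal (norm (summand i p) powr s) \<partial>joint) =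
      (\<integral>\<^sup>+p. ennreal (opnorm (C i (fst p)) powr s) * ennreal (norm (snd p i) powr s) \<partial>joint)"
    by (intro nn_integral_cong) (simp add: ennreal_mult)
  also have "\<dots> = (\<integral>\<^sup>+\<omega>. ennreal (opnorm (C i \<omega>) powr s) \<partial>M) * (\<integral>\<^sup>+\<omega>. ennreal (norm (R \<omega>) powr s) \<partial>P)"
    using opnorm_C_meas[OF i] by (intro nn_integral_coordinate[OF i, of "\<lambda>\<omega>. ennreal (opnorm (C i \<omega>) powr s)" "\<lambda>x. ennreal (norm x powr s)"]) auto
  also have "\<dots> = ennreal ((\<integral>\<omega>. opnorm (C i \<omega>) powr s \<partial>M) * (\<integral>\<omega>. norm (R \<omega>) powr s \<partial>P))"
    using c R by (simp add: nn_integral_eq_integral ennreal_mult)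
  finally show "(\<integral>\<^sup>+p. ennreal (norm (summand i p) powr s) \<partial>joint) =
      ennreal ((\<integral>\<omega>. opnorm (C i \<omega>) powr s \<partial>M) * (\<integral>\<omega>. norm (R \<omega>) powr s \<partial>P))" .
qed (use i in \<open>auto intro!: mult_nonneg_nonneg\<close>)

text \<open>The factors coming from \<open>C\<close> and \<open>Q\<close> may be dependent; they share the exponent \<open>s\<close> and are separated by
  \<open>a\<^sup>e b\<^sup>s\<^sup>-\<^sup>e \<le> a\<^sup>s + b\<^sup>s\<close>. The factors coming from the copies of \<open>R\<close> are independent for \<open>i \<noteq> l\<close>, which is why
  only the orders \<open>e\<close> and \<open>s - e\<close> enter for \<open>R\<close>.\<close>
lemma integrable_mixed_summands:
  assumes il: "i \<in> {0..N}" "l \<in> {0..N}" "i \<noteq> l" and e: "0 < e" "e < s"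
    and c: "\<And>k. k \<in> {1..N} \<Longrightarrow> integrable M (\<lambda>\<omega>. opnorm (C k \<omega>) powr s)"
    and q: "integrable M (\<lambda>\<omega>. norm (Q \<omega>) powr s)"
    and R1: "integrable P (\<lambda>\<omega>. norm (R \<omega>) powr e)" and R2: "integrable P (\<lambda>\<omega>. norm (R \<omega>) powr (s - e))"
  shows "integrable joint (\<lambda>p. norm (summand i p) powr e * norm (summand l p) powr (s - e))"
proof -
  define a where "a k \<omega> = (if k = 0 then norm (Q \<omega>) else opnorm (C k \<omega>))" for k \<omega>
  have a_meas: "a k \<in> borel_measurable M" if "k \<in> {0..N}" for k
    using that opnorm_C_meas[of k] by (cases "k = 0") (auto simp: a_def[abs_def])
  note [measurable] = a_meas[OF il(1)] a_meas[OF il(2)]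
  have a0: "0 \<le> a k \<omega>" for k \<omega> by (simp add: a_def opnorm_nonneg)
  have a_int: "integrable M (\<lambda>\<omega>. a k \<omega> powr s)" if "k \<in> {0..N}" for k
    using that c[of k] q by (cases "k = 0") (auto simp: a_def[abs_def])
  have "integrable M (\<lambda>\<omega>. a i \<omega> powr e * a l \<omega> powr (s - e))"
  proof (rule Bochner_Integration.integrable_bound[OF Bochner_Integration.integrable_add[OF a_int[OF il(1)] a_int[OF il(2)]]])
    show "AE \<omega> in M. norm (a i \<omega> powr e * a l \<omega> powr (s - e)) \<le> norm (a i \<omega> powr s + a l \<omega> powr s)"
      using powr_mult_le_add_powr[OF a0 a0, of e s] e by (auto simp: abs_of_nonneg)
  qed measurable
  then have fin_a: "(\<integral>\<^sup>+\<omega>. ennreal (a i \<omega> powr e * a l \<omega> powr (s - e)) \<partial>M) < \<infinity>"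
    by (subst nn_integral_eq_integral) auto
  have fin_R: "(\<integral>\<^sup>+\<omega>. ennreal (norm (R \<omega>) powr e) \<partial>P) < \<infinity>" "(\<integral>\<^sup>+\<omega>. ennreal (norm (R \<omega>) powr (s - e)) \<partial>P) < \<infinity>"
    using R1 R2 by (simp_all add: nn_integral_eq_integral)
  define A where "A \<omega> = ennreal (a i \<omega> powr e * a l \<omega> powr (s - e))" for \<omega>
  have [measurable]: "A \<in> borel_measurable M" unfolding A_def by measurable
  have norm_s: "norm (summand k p) = (if k = 0 then a k (fst p) else a k (fst p) * norm (snd p k))"
    if "k \<in> {0..N}" "p \<in> space joint" for k p
    using that norm_C_mult[of k "fst p" "snd p k"]
    by (auto simp: summand_def a_def joint_def space_pair_measure)
  have "(\<integral>\<^sup>+p. ennreal (norm (summand i p) powr e * norm (summand l p) powr (s - e)) \<partial>joint) < \<infinity>"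
  proof -
    consider "i \<noteq> 0" "l \<noteq> 0" | "i = 0" "l \<noteq> 0" | "l = 0" "i \<noteq> 0" using il by auto
    then show ?thesis
    proof cases
      case 1
      have "(\<integral>\<^sup>+p. ennreal (norm (summand i p) powr e * norm (summand l p) powr (s - e)) \<partial>joint) =
        (\<integral>\<^sup>+p. A (fst p) * (ennreal (norm (snd p i) powr e) * ennreal (norm (snd p l) powr (s - e))) \<partial>joint)"
        using 1 il by (intro nn_integral_cong)
          (simp add: norm_s A_def powr_mult a0 ennreal_mult[symmetric] mult_ac)
      also have "\<dots> = (\<integral>\<^sup>+\<omega>. A \<omega> \<partial>M) * ((\<integral>\<^sup>+\<omega>. ennreal (norm (R \<omega>) powr e) \<partial>P) * (\<integral>\<^sup>+\<omega>. ennreal (norm (R \<omega>) powr (s - e)) \<partial>P))"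
        using 1 il by (intro nn_integral_two_coordinates[of i l A "\<lambda>x. ennreal (norm x powr e)" "\<lambda>x. ennreal (norm x powr (s - e))"]) auto
      finally show ?thesis using fin_a fin_R by (simp add: A_def ennreal_mult_less_top)
    next
      case 2
      have "(\<integral>\<^sup>+p. ennreal (norm (summand i p) powr e * norm (summand l p) powr (s - e)) \<partial>joint) =
        (\<integral>\<^sup>+p. A (fst p) * ennreal (norm (snd p l) powr (s - e)) \<partial>joint)"
        using 2 il by (intro nn_integral_cong)
          (simp add: norm_s A_def powr_mult a0 ennreal_mult[symmetric] mult_ac)
      also have "\<dots> = (\<integral>\<^sup>+\<omega>. A \<omega> \<partial>M) * (\<integral>\<^sup>+\<omega>. ennreal (norm (R \<omega>) powr (s - e)) \<partial>P)"
        using 2 il by (intro nn_integral_coordinate[of l A "\<lambda>x. ennreal (norm x powr (s - e))"]) auto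
      finally show ?thesis using fin_a fin_R by (simp add: A_def ennreal_mult_less_top)
    next
      case 3
      have "(\<integral>\<^sup>+p. ennreal (norm (summand i p) powr e * norm (summand l p) powr (s - e)) \<partial>joint) =
        (\<integral>\<^sup>+p. A (fst p) * ennreal (norm (snd p i) powr e) \<partial>joint)"
        using 3 il by (intro nn_integral_cong)
          (simp add: norm_s A_def powr_mult a0 ennreal_mult[symmetric] mult_ac)
      also have "\<dots> = (\<integral>\<^sup>+\<omega>. A \<omega> \<partial>M) * (\<integral>\<^sup>+\<omega>. ennreal (norm (R \<omega>) powr e) \<partial>P)"
        using 3 il by (intro nn_integral_coordinate[of i A "\<lambda>x. ennreal (norm x powr e)"]) auto
      finally show ?thesis using fin_a fin_R by (simp add: A_def ennreal_mult_less_top)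
    qed
  qed
  then show ?thesis using il by (intro integrableI_nonneg) auto
qed

text \<open>The function \<open>m\<close> of the smoothing transform, as a real number.\<close>
definition total_moment :: "real \<Rightarrow> real" where
  "total_moment s = (\<Sum>i=1..N. \<integral>\<omega>. opnorm (C i \<omega>) powr s \<partial>M)"

text \<open>One step of the continuation. The identity \<open>(1 - m(s)) E |R|\<^sup>s = s D(s) + E |Q|\<^sup>s\<close> for \<open>s < \<gamma>\<close> has a
  right-hand side that is holomorphic around \<open>\<gamma>\<close>; dividing by \<open>1 - m\<close> continues the moment function, and
  Landau's lemma turns the continuation into a finite moment. The assumption beyond \<open>\<gamma>\<close> guarantees that
  \<open>1 - m\<close> does not vanish identically.\<close>
lemma moment_step:
  assumes \<gamma>: "0 < \<gamma>" "\<gamma> < T"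
    and R: "\<And>p. 0 < p \<Longrightarrow> p < \<gamma> \<Longrightarrow> integrable P (\<lambda>\<omega>. norm (R \<omega>) powr p)"
    and c: "\<And>i s. i \<in> {1..N} \<Longrightarrow> 0 < s \<Longrightarrow> s \<le> T \<Longrightarrow> integrable M (\<lambda>\<omega>. opnorm (C i \<omega>) powr s)"
    and q: "\<And>s. 0 < s \<Longrightarrow> s \<le> T \<Longrightarrow> integrable M (\<lambda>\<omega>. norm (Q \<omega>) powr s)"
    and nz: "\<And>s. \<gamma> < s \<Longrightarrow> s \<le> T \<Longrightarrow> total_moment s \<noteq> 1"
    and pole: "total_moment \<gamma> = 1 \<Longrightarrow> ((\<lambda>s. (\<gamma> - s) * (\<integral>\<omega>. norm (R \<omega>) powr s \<partial>P)) \<longlongrightarrow> 0) (at_left \<gamma>)"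
  shows "\<exists>s>\<gamma>. integrable P (\<lambda>\<omega>. norm (R \<omega>) powr s)"
proof -
  \<comment> \<open>The width \<open>\<delta>\<close> is so small compared with \<open>e\<close> that, for every exponent \<open>s\<close> of the strip, both \<open>e\<close> and
  \<open>s - e\<close> lie in \<open>(0, \<gamma>)\<close>, where the moments of \<open>R\<close> are known to be finite.\<close>
  define e where "e = min 1 (\<gamma> / 2)"
  define \<delta> where "\<delta> = min (e / 2) ((T - \<gamma>) / 2)"
  define a b where "a = \<gamma> - \<delta>" and "b = \<gamma> + \<delta>"
  have e: "0 < e" "e \<le> 1" "e \<le> \<gamma> / 2" using \<gamma> by (auto simp: e_def)
  have \<delta>: "0 < \<delta>" "\<delta> \<le> e / 2" "\<delta> \<le> (T - \<gamma>) / 2" using \<gamma> e unfolding \<delta>_def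
    by (simp, simp only: min.cobounded1, simp only: min.cobounded2)
  have "2 * \<delta> \<le> T - \<gamma>" "2 * \<delta> \<le> e" "2 * e \<le> \<gamma>" using \<delta> e by simp_all
  then have ab: "0 < a" "a < b" "b < T" "e < a" "0 < a - e" "b - e < \<gamma>"
    unfolding a_def b_def using e(1) \<delta>(1) \<gamma> by simp_all
  have strip: "ball (complex_of_real \<gamma>) \<delta> \<subseteq> {z. a < Re z \<and> Re z < b}"
  proof
    fix z assume "z \<in> ball (complex_of_real \<gamma>) \<delta>"
    then have "norm (z - complex_of_real \<gamma>) < \<delta>" by (simp add: dist_norm norm_minus_commute)
    then have "\<bar>Re (z - complex_of_real \<gamma>)\<bar> < \<delta>" using abs_Re_le_cmod le_less_trans by blast
    then show "z \<in> {z. a < Re z \<and> Re z < b}" by (simp add: a_def b_def abs_less_iff)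
  qed
  have "\<forall>i\<in>{1..N}. \<exists>F. F holomorphic_on {z. a < Re z \<and> Re z < b} \<and>
       (\<forall>s. F (complex_of_real s) = complex_of_real (\<integral>\<omega>. opnorm (C i \<omega>) powr s \<partial>M))"
    using ab by (intro ballI holomorphic_power_moment c opnorm_C_meas opnorm_nonneg) auto
  from bchoice[OF this] obtain m where m: "\<And>i. i \<in> {1..N} \<Longrightarrow> m i holomorphic_on {z. a < Re z \<and> Re z < b}"
    "\<And>i s. i \<in> {1..N} \<Longrightarrow> m i (complex_of_real s) = complex_of_real (\<integral>\<omega>. opnorm (C i \<omega>) powr s \<partial>M)"
    by blast
  have "\<exists>F. F holomorphic_on {z. a < Re z \<and> Re z < b} \<and>
       (\<forall>s. F (complex_of_real s) = complex_of_real (\<integral>\<omega>. norm (Q \<omega>) powr s \<partial>M))"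
    using ab by (intro holomorphic_power_moment q) auto
  then obtain Fq where Fq: "Fq holomorphic_on {z. a < Re z \<and> Re z < b}"
    "\<And>s. Fq (complex_of_real s) = complex_of_real (\<integral>\<omega>. norm (Q \<omega>) powr s \<partial>M)" by blast
  have "\<exists>D. D holomorphic_on {z. a < Re z \<and> Re z < b} \<and>
     (\<forall>s>0. integrable joint (\<lambda>p. norm (\<Sum>i\<in>{0..N}. summand i p) powr s) \<longrightarrow>
        (\<forall>i\<in>{0..N}. integrable joint (\<lambda>p. norm (summand i p) powr s)) \<longrightarrow>
        D (complex_of_real s) =
          complex_of_real (((\<integral>p. norm (\<Sum>i\<in>{0..N}. summand i p) powr s \<partial>joint) - (\<Sum>i\<in>{0..N}. \<integral>p. norm (summand i p) powr s \<partial>joint)) / s))"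
  proof (rule holomorphic_defect[OF prob_joint, where e = e])
    fix s and i l :: nat assume s: "s \<in> {a, b}" and il: "i \<in> {0..N}" "l \<in> {0..N}" "i \<noteq> l"
    show "integrable joint (\<lambda>p. norm (summand i p) powr e * norm (summand l p) powr (s - e))"
      by (rule integrable_mixed_summands[OF il]) (use s ab e \<gamma> in \<open>auto intro!: c q R\<close>)
  qed (use e ab in auto)
  then obtain D where D: "D holomorphic_on {z. a < Re z \<and> Re z < b}"
    "\<And>s. 0 < s \<Longrightarrow> integrable joint (\<lambda>p. norm (\<Sum>i\<in>{0..N}. summand i p) powr s) \<Longrightarrow>
        (\<forall>i\<in>{0..N}. integrable joint (\<lambda>p. norm (summand i p) powr s)) \<Longrightarrow>
        D (complex_of_real s) =
          complex_of_real (((\<integral>p. norm (\<Sum>i\<in>{0..N}. summand i p) powr s \<partial>joint) - (\<Sum>i\<in>{0..N}. \<integral>p. norm (summand i p) powr s \<partial>joint)) / s)"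
    by blast
  define f where "f z = 1 - (\<Sum>i=1..N. m i z)" for z
  have f_real: "f (complex_of_real s) = complex_of_real (1 - total_moment s)" for s
    by (simp add: f_def total_moment_def m(2))
  show ?thesis
  proof (rule moment_beyond_removable[where D = "\<lambda>z. z * D z + Fq z" and f = f and \<delta> = \<delta> and w = "complex_of_real (\<gamma> + \<delta> / 2)"])
    show "finite_measure P" using prob_P by (simp add: prob_space.finite_measure)
    show "(\<lambda>z. z * D z + Fq z) holomorphic_on ball (complex_of_real \<gamma>) \<delta>"
      by (rule holomorphic_on_subset[OF _ strip]) (intro holomorphic_intros D Fq)
    show "f holomorphic_on ball (complex_of_real \<gamma>) \<delta>" unfolding f_def
      by (rule holomorphic_on_subset[OF _ strip]) (intro holomorphic_intros m)
    show "complex_of_real (\<gamma> + \<delta> / 2) \<in> ball (complex_of_real \<gamma>) \<delta>"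
      using \<delta> by (simp add: dist_of_real dist_real_def del: of_real_add)
    have "total_moment (\<gamma> + \<delta> / 2) \<noteq> 1" using \<delta> by (intro nz) auto
    then show "f (complex_of_real (\<gamma> + \<delta> / 2)) \<noteq> 0"
      unfolding f_real by (metis eq_iff_diff_eq_0 of_real_eq_0_iff)
    show "((\<lambda>s. (\<gamma> - s) * (\<integral>\<omega>. norm (R \<omega>) powr s \<partial>P)) \<longlongrightarrow> 0) (at_left \<gamma>)" if "f (complex_of_real \<gamma>) = 0"
      using that unfolding f_real by (intro pole) (metis eq_iff_diff_eq_0 of_real_eq_0_iff)
    fix s assume s: "\<gamma> - \<delta> < s" "s < \<gamma>"
    have s0: "0 < s" "s \<le> T" using s ab \<gamma> by (auto simp: a_def)
    show iR: "integrable P (\<lambda>\<omega>. norm (R \<omega>) powr s)" using s s0 by (intro R) auto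
    define ER where "ER = (\<integral>\<omega>. norm (R \<omega>) powr s \<partial>P)"
    define EQ where "EQ = (\<integral>\<omega>. norm (Q \<omega>) powr s \<partial>M)"
    have "has_bochner_integral joint (\<lambda>p. norm (\<Sum>i\<in>{0..N}. summand i p) powr s) ER"
    proof (rule has_bochner_integral_nn_integral)
      show "(\<integral>\<^sup>+p. ennreal (norm (\<Sum>i\<in>{0..N}. summand i p) powr s) \<partial>joint) = ennreal ER"
        using nn_integral_sum_summand[of "\<lambda>x. ennreal (norm x powr s)"] iR
        by (simp add: ER_def nn_integral_eq_integral)
    qed (auto simp: ER_def)
    moreover have "has_bochner_integral joint (\<lambda>p. norm (summand 0 p) powr s) EQ"
    proof (rule has_bochner_integral_nn_integral)
      have "(\<integral>\<^sup>+p. ennreal (norm (summand 0 p) powr s) \<partial>joint) =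
          (\<integral>\<^sup>+\<omega>. ennreal (norm (Q \<omega>) powr s) \<partial>M) * (\<integral>\<^sup>+x. 1 \<partial>copies)"
        unfolding joint_def summand_def
        using nn_integral_pair_mult[of copies "\<lambda>\<omega>. ennreal (norm (Q \<omega>) powr s)" M "\<lambda>_. 1"]
          prob_space_imp_sigma_finite[OF prob_copies] by simp
      also have "\<dots> = ennreal EQ"
        using q[OF s0] prob_space.emeasure_space_1[OF prob_copies] by (simp add: EQ_def nn_integral_eq_integral)
      finally show "(\<integral>\<^sup>+p. ennreal (norm (summand 0 p) powr s) \<partial>joint) = ennreal EQ" .
    qed (auto simp: EQ_def)
    moreover have "has_bochner_integral joint (\<lambda>p. norm (summand i p) powr s) ((\<integral>\<omega>. opnorm (C i \<omega>) powr s \<partial>M) * ER)"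
      if "i \<in> {1..N}" for i
      unfolding ER_def using that s0 by (intro integrable_summand c iR) auto
    ultimately have hb: "has_bochner_integral joint (\<lambda>p. norm (\<Sum>i\<in>{0..N}. summand i p) powr s) ER"
      "has_bochner_integral joint (\<lambda>p. norm (summand 0 p) powr s) EQ"
      "\<And>i. i \<in> {1..N} \<Longrightarrow> has_bochner_integral joint (\<lambda>p. norm (summand i p) powr s) ((\<integral>\<omega>. opnorm (C i \<omega>) powr s \<partial>M) * ER)"
      by blast+
    have "(\<Sum>i\<in>{0..N}. \<integral>p. norm (summand i p) powr s \<partial>joint) = EQ + (\<Sum>i\<in>{1..N}. \<integral>p. norm (summand i p) powr s \<partial>joint)"
      using hb(2) by (subst sum.atLeast_Suc_atMost) (auto simp: has_bochner_integral_iff)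
    also have "(\<Sum>i\<in>{1..N}. \<integral>p. norm (summand i p) powr s \<partial>joint) = total_moment s * ER"
      unfolding total_moment_def sum_distrib_right using hb(3) by (intro sum.cong) (auto simp: has_bochner_integral_iff)
    finally have sumY: "(\<Sum>i\<in>{0..N}. \<integral>p. norm (summand i p) powr s \<partial>joint) = EQ + total_moment s * ER" .
    have "\<forall>i\<in>{0..N}. integrable joint (\<lambda>p. norm (summand i p) powr s)"
    proof
      fix i assume "i \<in> {0..N}"
      then show "integrable joint (\<lambda>p. norm (summand i p) powr s)"
        using hb(2) hb(3)[of i] by (cases "i = 0") (auto simp: has_bochner_integral_iff)
    qed
    then have "D (complex_of_real s) = complex_of_real ((ER - (EQ + total_moment s * ER)) / s)"
      using D(2)[OF s0(1)] hb(1) by (simp add: sumY has_bochner_integral_iff)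
    then have "complex_of_real s * D (complex_of_real s) + Fq (complex_of_real s) = complex_of_real ((1 - total_moment s) * ER)"
    proof -
      assume Ds: "D (complex_of_real s) = complex_of_real ((ER - (EQ + total_moment s * ER)) / s)"
      have "complex_of_real s * D (complex_of_real s) + Fq (complex_of_real s) =
          complex_of_real (s * ((ER - (EQ + total_moment s * ER)) / s) + EQ)"
        unfolding Ds Fq(2) EQ_def[symmetric] by simp
      also have "s * ((ER - (EQ + total_moment s * ER)) / s) + EQ = (1 - total_moment s) * ER"
        using s0 by (simp add: field_simps)
      finally show ?thesis .
    qed
    then show "f (complex_of_real s) * complex_of_real (\<integral>\<omega>. norm (R \<omega>) powr s \<partial>P) =
        complex_of_real s * D (complex_of_real s) + Fq (complex_of_real s)"
      unfolding f_real ER_def by simp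
  qed (use e \<delta> \<gamma> in auto)
qed

end

section \<open>Continuation up to the last moment of the weights\<close>
lemma integrable_powr_mono:
  fixes X :: "'a \<Rightarrow> real"
  assumes "finite_measure M" and [measurable]: "X \<in> borel_measurable M" and X0: "\<And>x. 0 \<le> X x"
    and ps: "0 < p" "p \<le> s" and int: "integrable M (\<lambda>x. X x powr s)"
  shows "integrable M (\<lambda>x. X x powr p)"
proof -
  interpret finite_measure M by fact
  have "integrable M (\<lambda>x. 1 + X x powr s)" using int by simp
  then show ?thesis
  proof (rule Bochner_Integration.integrable_bound)
    have "X x powr p \<le> 1 + X x powr s" for x
    proof (cases "X x \<le> 1")
      case True
      then have "X x powr p \<le> 1" using X0 ps by (cases "X x = 0") (auto intro: powr_le1)
      then show ?thesis by (simp add: add_increasing2)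
    next
      case False
      then have "X x powr p \<le> X x powr s" using ps by (intro powr_mono) auto
      then show ?thesis by simp
    qed
    then show "AE x in M. norm (X x powr p) \<le> norm (1 + X x powr s)" by simp
  qed measurable
qed

context smoothing_fixed_point
begin

text \<open>Let \<open>\<gamma>\<close> be the supremum of the orders of finite moments of \<open>R\<close>. If it were below \<open>S\<close>, one more step at
  \<open>\<gamma>\<close> would produce a finite moment of larger order. The tail hypothesis enters only when \<open>\<gamma> = \<beta>\<close>.\<close>
lemma all_moments_finite:
  fixes S :: ereal
  assumes \<beta>: "0 < \<beta>" "ereal \<beta> < S"
    and R: "\<And>p. 0 < p \<Longrightarrow> p < \<beta> \<Longrightarrow> integrable P (\<lambda>\<omega>. norm (R \<omega>) powr p)"
    and c: "\<And>i s. i \<in> {1..N} \<Longrightarrow> 0 < s \<Longrightarrow> ereal s < S \<Longrightarrow> integrable M (\<lambda>\<omega>. opnorm (C i \<omega>) powr s)"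
    and q: "\<And>s. 0 < s \<Longrightarrow> ereal s < S \<Longrightarrow> integrable M (\<lambda>\<omega>. norm (Q \<omega>) powr s)"
    and nz: "\<And>s. \<beta> < s \<Longrightarrow> ereal s < S \<Longrightarrow> total_moment s \<noteq> 1"
    and tail: "((\<lambda>t. t powr \<beta> * measure P {\<omega> \<in> space P. norm (R \<omega>) > t}) \<longlongrightarrow> 0) at_top"
    and s1: "0 < s1" "ereal s1 < S"
  shows "integrable P (\<lambda>\<omega>. norm (R \<omega>) powr s1)"
proof (rule ccontr)
  assume neg: "\<not> ?thesis"
  have fP: "finite_measure P" using prob_P by (simp add: prob_space.finite_measure)
  have down: "integrable P (\<lambda>\<omega>. norm (R \<omega>) powr p)" if "0 < p" "p \<le> s" "integrable P (\<lambda>\<omega>. norm (R \<omega>) powr s)" for p s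
    by (rule integrable_powr_mono[OF fP _ _ that]) auto
  \<comment> \<open>Inserting \<open>\<beta> / 2\<close>, an order known to have a finite moment, makes \<open>A\<close> visibly nonempty.\<close>
  define A where "A = insert (\<beta> / 2) {p. 0 < p \<and> integrable P (\<lambda>\<omega>. norm (R \<omega>) powr p)}"
  define \<gamma> where "\<gamma> = Sup A"
  have A: "p \<le> s1 \<and> 0 < p \<and> integrable P (\<lambda>\<omega>. norm (R \<omega>) powr p)" if "p \<in> A" for p
  proof -
    have "0 < p" "integrable P (\<lambda>\<omega>. norm (R \<omega>) powr p)" using that \<beta> R[of "\<beta>/2"] by (auto simp: A_def)
    moreover have "p \<le> s1" using down[of s1 p] calculation neg s1 by force
    ultimately show ?thesis by blast
  qed
  have A_ne: "A \<noteq> {}" by (simp add: A_def)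
  have bdd: "bdd_above A" using A by (auto intro!: bdd_aboveI)
  have up: "p \<le> \<gamma>" if "0 < p" "integrable P (\<lambda>\<omega>. norm (R \<omega>) powr p)" for p
    unfolding \<gamma>_def using that bdd by (intro cSup_upper) (auto simp: A_def)
  have "\<beta> \<le> \<gamma>"
  proof (rule dense_le_bounded[OF \<beta>(1)])
    show "p \<le> \<gamma>" if "0 < p" "p < \<beta>" for p using up R that by blast
  qed
  have "\<gamma> \<le> s1" unfolding \<gamma>_def using A by (intro cSup_least) (auto simp: A_def)
  then have "ereal \<gamma> < S" using s1(2) by (intro le_less_trans[of "ereal \<gamma>" "ereal s1" S]) simp_all
  then obtain T where T: "\<gamma> < T" "ereal T < S"
    using ereal_dense2[of "ereal \<gamma>" S] by auto
  have "\<exists>s>\<gamma>. integrable P (\<lambda>\<omega>. norm (R \<omega>) powr s)"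
  proof (rule moment_step[OF _ T(1)])
    show "0 < \<gamma>" using \<beta> \<open>\<beta> \<le> \<gamma>\<close> by simp
    have ltS: "ereal s < S" if "s \<le> T" for s using that T(2) by (intro le_less_trans[of "ereal s" "ereal T" S]) simp_all
    show "integrable P (\<lambda>\<omega>. norm (R \<omega>) powr p)" if "0 < p" "p < \<gamma>" for p
    proof -
      obtain s where "s \<in> A" "p < s" using \<open>p < \<gamma>\<close> less_cSup_iff[OF A_ne bdd, of p] by (auto simp: \<gamma>_def A_ne)
      then show ?thesis using A[of s] down[of p s] that by simp
    qed
    show "integrable M (\<lambda>\<omega>. opnorm (C i \<omega>) powr s)" if "i \<in> {1..N}" "0 < s" "s \<le> T" for i s
      using that by (intro c ltS)
    show "integrable M (\<lambda>\<omega>. norm (Q \<omega>) powr s)" if "0 < s" "s \<le> T" for s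
      using that by (intro q ltS)
    show "total_moment s \<noteq> 1" if "\<gamma> < s" "s \<le> T" for s
      using that \<open>\<beta> \<le> \<gamma>\<close> by (intro nz ltS) auto
    assume "total_moment \<gamma> = 1"
    then have "\<gamma> = \<beta>" using nz[of \<gamma>] \<open>\<beta> \<le> \<gamma>\<close> \<open>ereal \<gamma> < S\<close> by force
    show "((\<lambda>s. (\<gamma> - s) * (\<integral>\<omega>. norm (R \<omega>) powr s \<partial>P)) \<longlongrightarrow> 0) (at_left \<gamma>)"
      unfolding \<open>\<gamma> = \<beta>\<close> by (rule moment_at_critical_exponent[OF prob_P _ _ \<beta>(1) tail]) auto
  qed
  then obtain s where "\<gamma> < s" "integrable P (\<lambda>\<omega>. norm (R \<omega>) powr s)" by blast
  then show False using up[of s] \<beta> \<open>\<beta> \<le> \<gamma>\<close> by simp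
qed

end

lemma nn_integral_law_C:
  fixes C :: "nat \<Rightarrow> 'a \<Rightarrow> real ^ 'n ^ 'n"
  assumes "prob_space M" and N: "N \<ge> 1" and C: "\<And>i. i \<in> {1..N} \<Longrightarrow> C i \<in> borel_measurable M"
    and g: "g \<in> borel_measurable borel"
  shows "(\<integral>\<^sup>+A. g A \<partial>law_C M N C) = (\<Sum>i=1..N. \<integral>\<^sup>+\<omega>. g (C i \<omega>) \<partial>M) / of_nat N"
proof -
  interpret prob_space M by fact
  have s: "sets (uniform_count_measure {1..N} \<Otimes>\<^sub>M M) = sets (count_space {1..N} \<Otimes>\<^sub>M M)"
    by (intro sets_pair_measure_cong) (simp_all add: sets_uniform_count_measure)
  have "(\<lambda>p. C (fst p) (snd p)) \<in> borel_measurable (count_space {1..N} \<Otimes>\<^sub>M M)"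
    by (rule measurable_pair_measure_countable1) (use C in auto)
  then have m: "(\<lambda>(i, \<omega>). C i \<omega>) \<in> measurable (uniform_count_measure {1..N} \<Otimes>\<^sub>M M) borel"
    by (simp add: measurable_cong_sets[OF s refl] case_prod_beta')
  have "(\<integral>\<^sup>+A. g A \<partial>law_C M N C) = (\<integral>\<^sup>+p. g (C (fst p) (snd p)) \<partial>(uniform_count_measure {1..N} \<Otimes>\<^sub>M M))"
    unfolding law_C_def by (subst nn_integral_distr[OF m]) (use g in \<open>simp_all add: case_prod_beta'\<close>)
  also have "\<dots> = (\<integral>\<^sup>+i. \<integral>\<^sup>+\<omega>. g (C i \<omega>) \<partial>M \<partial>uniform_count_measure {1..N})"
    using measurable_compose[OF m g]
    by (subst nn_integral_fst[symmetric]) (simp_all add: case_prod_beta')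
  also have "\<dots> = (\<Sum>i=1..N. ennreal (1 / real (card {1..N})) * (\<integral>\<^sup>+\<omega>. g (C i \<omega>) \<partial>M))"
    unfolding uniform_count_measure_def by (subst nn_integral_point_measure_finite) auto
  also have "\<dots> = (\<Sum>i=1..N. \<integral>\<^sup>+\<omega>. g (C i \<omega>) \<partial>M) / of_nat N"
    using N by (simp add: sum_distrib_left[symmetric] divide_ennreal_def mult.commute inverse_ennreal ennreal_of_nat_eq_real_of_nat divide_inverse)
  finally show ?thesis .
qed

lemma m_fun_law_C:
  fixes C :: "nat \<Rightarrow> 'a \<Rightarrow> real ^ 'n ^ 'n"
  assumes "prob_space M" and N: "N \<ge> 1" and C: "\<And>i. i \<in> {1..N} \<Longrightarrow> C i \<in> borel_measurable M"
  shows "m_fun N (law_C M N C) s = (\<Sum>i=1..N. \<integral>\<^sup>+\<omega>. ennreal (opnorm (C i \<omega>) powr s) \<partial>M)"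
proof -
  have "moment (law_C M N C) opnorm s = (\<Sum>i=1..N. \<integral>\<^sup>+\<omega>. ennreal (opnorm (C i \<omega>) powr s) \<partial>M) / of_nat N"
    unfolding moment_def by (rule nn_integral_law_C[OF assms]) measurable
  then show ?thesis
    using N unfolding m_fun_def by (simp add: ennreal_times_divide mult.commute[of "of_nat N"] mult_divide_eq_ennreal)
qed

lemma integrable_iff_moment:
  assumes "Y \<in> borel_measurable M"
  shows "integrable M (\<lambda>x. Y x powr s) \<longleftrightarrow> moment M Y s < \<infinity>"
  using assms by (simp add: integrable_iff_bounded moment_def)

lemma finite_moment_below_ereal:
  assumes "prob_space M" and "Y \<in> borel_measurable M" and "\<And>x. 0 \<le> Y x"
    and "finite_moment_ereal M Y S" and "0 < s" "ereal s < S"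
  shows "integrable M (\<lambda>x. Y x powr s)"
proof (cases "S = \<infinity>")
  case True
  then show ?thesis using assms by (simp add: finite_moment_ereal_def integrable_iff_moment)
next
  case False
  then obtain t where t: "S = ereal t" using assms(6) by (cases S) auto
  then have "integrable M (\<lambda>x. Y x powr t)" using assms by (simp add: finite_moment_ereal_def integrable_iff_moment)
  moreover have "s \<le> t" using assms(6) t by simp
  ultimately show ?thesis
    by (intro integrable_powr_mono[OF prob_space.finite_measure[OF assms(1)] assms(2,3,5)])
qed

lemma finite_moment_below_s_infty:
  fixes \<mu> :: "(real ^ 'n ^ 'n) measure"
  assumes "prob_space \<mu>" "sets \<mu> = sets borel" "0 < s" "ereal s < s_infty \<mu>"
  shows "moment \<mu> opnorm s < \<infinity>"
proof -
  obtain t where t: "s < t" "0 < t" "moment \<mu> opnorm t < \<infinity>"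
    using assms(4) unfolding s_infty_def less_Sup_iff by auto
  have m: "opnorm \<in> borel_measurable \<mu>" using borel_measurable_opnorm measurable_cong_sets[OF assms(2) refl] by blast
  have "integrable \<mu> (\<lambda>x. opnorm x powr t)" using t m by (simp add: integrable_iff_moment)
  then have "integrable \<mu> (\<lambda>x. opnorm x powr s)"
    using onorm_pos_le[OF matrix_vector_mul_bounded_linear] less_imp_le[OF t(1)]
    by (intro integrable_powr_mono[OF prob_space.finite_measure[OF assms(1)] m _ assms(3)])
  then show ?thesis using m by (simp add: integrable_iff_moment)
qed

lemma prob_space_law_C:
  fixes C :: "nat \<Rightarrow> 'a \<Rightarrow> real ^ 'n ^ 'n"
  assumes "prob_space M" and N: "N \<ge> 1" and C: "\<And>i. i \<in> {1..N} \<Longrightarrow> C i \<in> borel_measurable M"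
  shows "prob_space (law_C M N C)"
proof
  have "emeasure (law_C M N C) (space (law_C M N C)) = (\<integral>\<^sup>+A. 1 \<partial>law_C M N C)" by simp
  also have "\<dots> = 1" using N mult_divide_eq_ennreal[of "of_nat N" 1] by (subst nn_integral_law_C[OF assms]) (auto simp: prob_space.emeasure_space_1[OF assms(1)])
  finally show "emeasure (law_C M N C) (space (law_C M N C)) = 1" .
qed

section \<open>Small elements of the generated group\<close>
lemma opnorm_eqI:
  fixes A :: "real ^ 'n ^ 'n"
  assumes "\<And>x. norm (A *v x) = c * norm x" "0 \<le> c"
  shows "opnorm A = c"
proof (rule antisym)
  show "opnorm A \<le> c" by (rule onorm_le) (simp add: assms)
  obtain i :: 'n where True by blast
  have "norm (A *v axis i 1) \<le> opnorm A * norm (axis i (1::real))"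
    by (rule onorm) (rule matrix_vector_mul_bounded_linear)
  then show "c \<le> opnorm A" by (simp add: assms)
qed

text \<open>Otherwise the trivial subgroup would be a closed subgroup containing the support.\<close>
lemma exists_nonzero_in_support:
  assumes "nonarithmetic \<nu>"
  shows "\<exists>x\<in>msupport \<nu>. x \<noteq> 0"
proof (rule ccontr)
  assume "\<not> ?thesis"
  then have sub: "msupport \<nu> \<subseteq> {0}" by blast
  have inv0: "inv\<^bsub>real_add_group\<^esub> 0 = (0::real)"
    unfolding m_inv_def by (rule the_equality) (auto simp: real_add_group_def)
  have "subgroup {0} real_add_group"
    by (rule subgroup.intro) (auto simp: inv0, auto simp: real_add_group_def)
  with sub have "{0} \<in> {H. subgroup H real_add_group \<and> closed H \<and> msupport \<nu> \<subseteq> H}" by simp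
  then have "\<Inter>{H. subgroup H real_add_group \<and> closed H \<and> msupport \<nu> \<subseteq> H} \<subseteq> {0}" by (rule Inter_lower)
  then have "(UNIV :: real set) \<subseteq> {0}" using assms unfolding nonarithmetic_def by simp
  then show False by (metis UNIV_I singletonD subsetD zero_neq_one)
qed

text \<open>The complement of the support is a union of open null sets, and second countability makes it a
  countable one.\<close>
lemma msupport_complement_null:
  fixes \<mu> :: "'a::second_countable_topology measure"
  assumes "sets \<mu> = sets borel"
  shows "\<exists>V \<in> sets borel. - msupport \<mu> \<subseteq> V \<and> emeasure \<mu> V = 0"
proof -
  define F where "F = {U. open U \<and> emeasure \<mu> U = 0}"
  obtain F' where F': "F' \<subseteq> F" "countable F'" "\<Union>F' = \<Union>F"
    using Lindelof[of F] by (auto simp: F_def)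
  have "\<Union>F' \<in> null_sets \<mu>"
  proof -
    have "(\<Union>U\<in>F'. U) \<in> null_sets \<mu>"
      using F' by (intro null_sets_UN') (auto simp: F_def null_sets_def assms)
    then show ?thesis by simp
  qed
  moreover have "- msupport \<mu> \<subseteq> \<Union>F'"
    unfolding F'(3) by (auto simp: msupport_def F_def not_gr_zero)
  ultimately show ?thesis using assms by (intro bexI[of _ "\<Union>F'"]) auto
qed

text \<open>Matrices of norm different from \<open>1\<close> have positive mass under the law of \<open>C\<close>, while the complement of the
  support has none. Hence some actual value \<open>C i \<omega>\<close> lies in the support and has such a norm; taking a value,
  rather than an arbitrary point of the support, ensures that it is a similarity.\<close>
lemma exists_generator_off_unit_norm:
  fixes C :: "nat \<Rightarrow> 'a \<Rightarrow> real ^ 'n ^ 'n"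
  assumes "prob_space M" and N: "N \<ge> 1" and C: "\<And>i. i \<in> {1..N} \<Longrightarrow> C i \<in> borel_measurable M"
    and sim: "\<And>i \<omega>. i \<in> {1..N} \<Longrightarrow> \<omega> \<in> space M \<Longrightarrow> C i \<omega> \<in> similarities"
    and na: "nonarithmetic (distr M borel (\<lambda>\<omega>. ln (opnorm (C 1 \<omega>))))"
  shows "\<exists>g \<in> msupport (law_C M N C) \<inter> similarities. opnorm g > 0 \<and> opnorm g \<noteq> 1"
proof -
  define \<mu> where "\<mu> = law_C M N C"
  have sets_\<mu>: "sets \<mu> = sets borel" by (simp add: \<mu>_def law_C_def)
  have m1: "(\<lambda>\<omega>. opnorm (C 1 \<omega>)) \<in> borel_measurable M"
    using N by (intro measurable_compose[OF C borel_measurable_opnorm]) auto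
  obtain x where x: "x \<in> msupport (distr M borel (\<lambda>\<omega>. ln (opnorm (C 1 \<omega>))))" "x \<noteq> 0"
    using exists_nonzero_in_support[OF na] by blast
  have pos: "0 < opnorm g" if gs: "g \<in> similarities" for g :: "real ^ 'n ^ 'n"
  proof (rule ccontr)
    assume "\<not> 0 < opnorm g"
    then have "opnorm g = 0" using onorm_pos_le[OF matrix_vector_mul_bounded_linear[of g]] by simp
    then have "norm (g *v y) = 0" for y using gs by (simp add: similarities_def)
    then have z: "g *v y = 0" for y by simp
    obtain h where h: "h ** g = mat 1" using gs by (auto simp: similarities_def invertible_def)
    have "y = 0" for y :: "real ^ 'n"
    proof -
      have "y = (h ** g) *v y" by (simp add: h)
      also have "\<dots> = 0" by (simp add: z flip: matrix_vector_mul_assoc)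
      finally show ?thesis .
    qed
    from this[of "axis undefined 1"] show False by (simp add: axis_eq_0_iff)
  qed
  define U where "U = {A :: real ^ 'n ^ 'n. 0 < opnorm A \<and> opnorm A \<noteq> 1}"
  have U [measurable]: "U \<in> sets borel"
    unfolding U_def by measurable
  have U_pos: "0 < emeasure M {\<omega> \<in> space M. C 1 \<omega> \<in> U}"
  proof -
    have "0 < emeasure (distr M borel (\<lambda>\<omega>. ln (opnorm (C 1 \<omega>)))) (- {0})"
      using x unfolding msupport_def by auto
    also have "\<dots> = emeasure M ((\<lambda>\<omega>. ln (opnorm (C 1 \<omega>))) -` (- {0}) \<inter> space M)"
      using m1 by (intro emeasure_distr) auto
    also have "(\<lambda>\<omega>. ln (opnorm (C 1 \<omega>))) -` (- {0}) \<inter> space M = {\<omega> \<in> space M. C 1 \<omega> \<in> U}"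
      using pos[OF sim[of 1]] N by (auto simp: U_def)
    finally show ?thesis .
  qed
  obtain V where V: "V \<in> sets borel" "- msupport \<mu> \<subseteq> V" "emeasure \<mu> V = 0"
    using msupport_complement_null[OF sets_\<mu>] by blast
  have law: "(\<integral>\<^sup>+A. indicator B A \<partial>\<mu>) = (\<Sum>i=1..N. \<integral>\<^sup>+\<omega>. indicator B (C i \<omega>) \<partial>M) / of_nat N"
    if "B \<in> sets borel" for B :: "(real ^ 'n ^ 'n) set"
    unfolding \<mu>_def by (rule nn_integral_law_C[OF assms(1) N C]) (use that in auto)
  have "\<exists>i\<in>{1..N}. \<exists>\<omega>\<in>space M. C i \<omega> \<in> U - V"
  proof (rule ccontr)
    assume neg: "\<not> ?thesis"
    have "(\<integral>\<^sup>+A. indicator U A \<partial>\<mu>) \<le> (\<integral>\<^sup>+A. indicator (U - V) A + indicator V A \<partial>\<mu>)"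
      by (intro nn_integral_mono) (auto split: split_indicator)
    also have "\<dots> = (\<integral>\<^sup>+A. indicator (U - V) A \<partial>\<mu>) + (\<integral>\<^sup>+A. indicator V A \<partial>\<mu>)"
      using U V by (intro nn_integral_add) (auto simp: measurable_cong_sets[OF sets_\<mu> refl])
    also have "(\<integral>\<^sup>+A. indicator V A \<partial>\<mu>) = 0" using V by (simp add: sets_\<mu>)
    also have "(\<integral>\<^sup>+A. indicator (U - V) A \<partial>\<mu>) = 0"
    proof -
      have "(\<integral>\<^sup>+\<omega>. indicator (U - V) (C i \<omega>) \<partial>M) = 0" if "i \<in> {1..N}" for i
        using neg that by (subst nn_integral_cong[of M _ "\<lambda>_. 0"]) (auto simp: indicator_def)
      then show ?thesis using U V by (subst law) auto
    qed
    finally have "(\<Sum>i=1..N. \<integral>\<^sup>+\<omega>. indicator U (C i \<omega>) \<partial>M) / of_nat N = 0"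
      using law[OF U] by simp
    then have "\<forall>i\<in>{1..N}. (\<integral>\<^sup>+\<omega>. indicator U (C i \<omega>) \<partial>M) = 0"
      by (auto simp: ennreal_divide_eq_0_iff)
    then have "(\<integral>\<^sup>+\<omega>. indicator U (C 1 \<omega>) \<partial>M) = 0" using N by auto
    moreover have "(\<integral>\<^sup>+\<omega>. indicator U (C 1 \<omega>) \<partial>M) = emeasure M {\<omega> \<in> space M. C 1 \<omega> \<in> U}"
    proof -
      have "{\<omega> \<in> space M. C 1 \<omega> \<in> U} \<in> sets M"
        using measurable_sets[OF C[of 1] U] N by (simp add: vimage_def Int_def conj_commute)
      then have "emeasure M {\<omega> \<in> space M. C 1 \<omega> \<in> U} = (\<integral>\<^sup>+\<omega>. indicator {\<omega> \<in> space M. C 1 \<omega> \<in> U} \<omega> \<partial>M)"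
        by (rule nn_integral_indicator[symmetric])
      also have "\<dots> = (\<integral>\<^sup>+\<omega>. indicator U (C 1 \<omega>) \<partial>M)"
        by (intro nn_integral_cong) (simp add: indicator_def)
      finally show ?thesis by (rule sym)
    qed
    ultimately show False using U_pos by simp
  qed
  then obtain i \<omega> where "i \<in> {1..N}" "\<omega> \<in> space M" "C i \<omega> \<in> U - V" by blast
  then show ?thesis using V sim[of i \<omega>] unfolding \<mu>_def[symmetric] U_def by (intro bexI[of _ "C i \<omega>"]) auto
qed

lemma similarity_inverse:
  assumes g: "g \<in> similarities" and pos: "0 < opnorm g"
  shows "inv\<^bsub>similarity_group\<^esub> g \<in> similarities" "opnorm (inv\<^bsub>similarity_group\<^esub> g) = 1 / opnorm g"
proof -
  obtain h where h: "g ** h = mat 1" "h ** g = mat 1" using g by (auto simp: similarities_def invertible_def)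
  have "norm (h *v x) = 1 / opnorm g * norm x" for x
  proof -
    have "norm x = norm (g *v (h *v x))" by (simp add: matrix_vector_mul_assoc h)
    also have "\<dots> = opnorm g * norm (h *v x)" using g by (simp add: similarities_def)
    finally show ?thesis using pos by simp
  qed
  then have op: "opnorm h = 1 / opnorm g" and nh: "\<And>x. norm (h *v x) = opnorm h * norm x"
    using opnorm_eqI[of h "1 / opnorm g"] pos by auto
  have hs: "h \<in> similarities" using h nh by (auto simp: similarities_def invertible_def)
  have "inv\<^bsub>similarity_group\<^esub> g = h"
    unfolding m_inv_def
  proof (rule the_equality)
    show "h \<in> carrier similarity_group \<and> g \<otimes>\<^bsub>similarity_group\<^esub> h = \<one>\<^bsub>similarity_group\<^esub> \<and> h \<otimes>\<^bsub>similarity_group\<^esub> g = \<one>\<^bsub>similarity_group\<^esub>"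
      using hs h by (simp add: similarity_group_def)
    fix y assume "y \<in> carrier similarity_group \<and> g \<otimes>\<^bsub>similarity_group\<^esub> y = \<one>\<^bsub>similarity_group\<^esub> \<and> y \<otimes>\<^bsub>similarity_group\<^esub> g = \<one>\<^bsub>similarity_group\<^esub>"
    then have "y ** g = mat 1" by (simp add: similarity_group_def)
    then have "y ** (g ** h) = h" by (simp add: matrix_mul_assoc)
    then show "y = h" by (simp add: h)
  qed
  then show "inv\<^bsub>similarity_group\<^esub> g \<in> similarities" "opnorm (inv\<^bsub>similarity_group\<^esub> g) = 1 / opnorm g"
    using hs op by simp_all
qed

text \<open>Either \<open>g\<close> or its inverse contracts, and the powers of the contraction are the elements along which
  the limit defining the tail measure is evaluated.\<close>
lemma exists_contracting_powers:
  assumes g: "g \<in> msupport \<mu> \<inter> similarities" "0 < opnorm g" "opnorm g \<noteq> 1"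
  shows "\<exists>q a. 0 < q \<and> q < 1 \<and> (\<forall>n::nat. a n \<in> G_gen \<mu> \<and> (\<forall>x. norm (a n *v x) = q ^ n * norm x))"
proof -
  have "\<exists>h \<in> G_gen \<mu>. h \<in> similarities \<and> 0 < opnorm h \<and> opnorm h < 1"
  proof (cases "opnorm g < 1")
    case True
    then show ?thesis using g by (intro bexI[of _ g]) (auto simp: G_gen_def intro: generate.incl)
  next
    case False
    have "inv\<^bsub>similarity_group\<^esub> g \<in> G_gen \<mu>" unfolding G_gen_def using g by (intro generate.inv)
    then show ?thesis using similarity_inverse[of g] g False by (intro bexI[of _ "inv\<^bsub>similarity_group\<^esub> g"]) auto
  qed
  then obtain h where h: "h \<in> G_gen \<mu>" "h \<in> similarities" "0 < opnorm h" "opnorm h < 1" by blast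
  define a where "a n = ((\<lambda>B. h ** B) ^^ n) (mat 1)" for n :: nat
  have "a n \<in> G_gen \<mu>" for n
  proof (induction n)
    case 0
    show ?case using generate.one[of similarity_group "msupport \<mu> \<inter> similarities"]
      by (simp add: a_def G_gen_def similarity_group_def)
  next
    case (Suc n)
    then show ?case using generate.eng[of h similarity_group "msupport \<mu> \<inter> similarities" "a n"] h(1)
      by (simp add: a_def G_gen_def similarity_group_def)
  qed
  moreover have "norm (a n *v x) = opnorm h ^ n * norm x" for n x
  proof (induction n)
    case (Suc n)
    have "norm (a (Suc n) *v x) = norm (h *v (a n *v x))" by (simp add: a_def matrix_vector_mul_assoc)
    also have "\<dots> = opnorm h * norm (a n *v x)" using h by (simp add: similarities_def)
    finally show ?case by (simp add: Suc)
  qed (simp add: a_def)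
  ultimately show ?thesis using h by (intro exI[of _ "opnorm h"] exI[of _ a]) auto
qed

section \<open>Positivity of the spherical part\<close>
definition annulus_bump :: "'a::real_normed_vector \<Rightarrow> real" where
  "annulus_bump x = max 0 (min 1 (min (2 * norm x - 1) (3 - norm x)))"

lemma annulus_bump_ge: "1 < norm x \<Longrightarrow> norm x \<le> 2 \<Longrightarrow> annulus_bump x = 1"
  and annulus_bump_bounds: "0 \<le> annulus_bump x" "annulus_bump x \<le> 1"
  by (auto simp: annulus_bump_def)

lemma continuous_on_annulus_bump: "continuous_on A annulus_bump"
  unfolding annulus_bump_def by (intro continuous_intros)

lemma annulus_bump_Cc: "(annulus_bump :: real ^ 'n \<Rightarrow> real) \<in> Cc_punctured"
proof -
  have "compact (cball (0 :: real ^ 'n) 3 - ball 0 (1/2))" by (intro compact_diff) auto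
  moreover have "annulus_bump x = 0" if "x \<notin> cball 0 3 - ball 0 (1/2)" for x :: "real ^ 'n"
    using that by (auto simp: annulus_bump_def)
  moreover have "cball 0 3 - ball 0 (1/2) \<subseteq> - {0 :: real ^ 'n}" by auto
  ultimately show ?thesis
    unfolding Cc_punctured_def using continuous_on_annulus_bump by blast
qed

text \<open>With \<open>t = 1 / q\<^sup>n\<close> the bump at \<open>a\<^sub>n R\<close> dominates the indicator of \<open>t < |R| \<le> 2 t\<close>, whose probability is of
  exact order \<open>K (1 - 2\<^sup>-\<^sup>\<beta>) t\<^sup>-\<^sup>\<beta>\<close>.\<close>
lemma tail_measure_nonzero:
  fixes R :: "'b \<Rightarrow> real ^ 'n" and \<mu> :: "(real ^ 'n ^ 'n) measure"
  assumes "prob_space P" and [measurable]: "R \<in> borel_measurable P" and \<beta>: "0 < \<beta>" and Kpos: "0 < K"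
    and K: "((\<lambda>t. t powr \<beta> * measure P {\<omega> \<in> space P. norm (R \<omega>) > t}) \<longlongrightarrow> K) at_top"
    and tm: "is_tail_measure \<mu> \<beta> P R \<Lambda>"
    and g: "g \<in> msupport \<mu> \<inter> similarities" "0 < opnorm g" "opnorm g \<noteq> 1"
  shows "0 < (\<integral>x. annulus_bump x \<partial>\<Lambda>)"
proof -
  interpret prob_space P by fact
  obtain q a where q: "0 < q" "q < 1" and a: "\<And>n. a n \<in> G_gen \<mu>" "\<And>n x. norm (a n *v x) = q ^ n * norm x"
    using exists_contracting_powers[OF g] by blast
  have op: "opnorm (a n) = q ^ n" for n using a(2) q by (intro opnorm_eqI) auto
  define T where "T t = t powr \<beta> * prob {\<omega> \<in> space P. norm (R \<omega>) > t}" for t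
  have q0: "(\<lambda>n. q ^ n) \<longlonglongrightarrow> 0" using q by (intro LIMSEQ_power_zero) auto
  have "filterlim a (opnorm going_to (at_right 0) within (G_gen \<mu>)) sequentially"
    unfolding going_to_within_def filterlim_inf filterlim_principal filterlim_filtercomap_iff
    using a(1) q q0 by (auto simp: o_def op filterlim_at)
  from filterlim_compose[OF bspec[OF conjunct2[OF tm[unfolded is_tail_measure_def]] annulus_bump_Cc] this]
  have lim1: "(\<lambda>n. (q ^ n) powr (- \<beta>) * (\<integral>\<omega>. annulus_bump (a n *v R \<omega>) \<partial>P)) \<longlonglongrightarrow> (\<integral>x. annulus_bump x \<partial>\<Lambda>)"
    by (simp add: op)
  have tn: "filterlim (\<lambda>n. 1 / q ^ n) at_top sequentially"
    using filterlim_inverse_at_top[OF q0] q by (simp add: divide_inverse)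
  have tn2: "filterlim (\<lambda>n. 2 * (1 / q ^ n)) at_top sequentially"
    by (rule filterlim_tendsto_pos_mult_at_top[OF tendsto_const _ tn]) simp
  have "(\<lambda>n. T (1 / q ^ n) - 2 powr (- \<beta>) * T (2 * (1 / q ^ n))) \<longlonglongrightarrow> K - 2 powr (- \<beta>) * K"
    unfolding T_def by (intro tendsto_intros filterlim_compose[OF K tn] filterlim_compose[OF K tn2])
  moreover have "T (1 / q ^ n) - 2 powr (- \<beta>) * T (2 * (1 / q ^ n)) \<le> (q ^ n) powr (- \<beta>) * (\<integral>\<omega>. annulus_bump (a n *v R \<omega>) \<partial>P)" for n
  proof -
    define t where "t = 1 / q ^ n"
    have t: "0 < t" "(q ^ n) powr (- \<beta>) = t powr \<beta>" using q by (simp_all add: t_def powr_minus_divide powr_divide)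
    have bm: "(\<lambda>\<omega>. annulus_bump (a n *v R \<omega>)) \<in> borel_measurable P"
    proof -
      have [measurable]: "annulus_bump \<in> borel_measurable (borel :: (real ^ 'n) measure)"
        by (intro borel_measurable_continuous_onI continuous_on_annulus_bump)
      show ?thesis by measurable
    qed
    have "prob {\<omega> \<in> space P. norm (R \<omega>) > t} - prob {\<omega> \<in> space P. norm (R \<omega>) > 2 * t} =
        prob ({\<omega> \<in> space P. norm (R \<omega>) > t} - {\<omega> \<in> space P. norm (R \<omega>) > 2 * t})"
      using t by (intro finite_measure_Diff[symmetric]) auto
    also have "\<dots> = (\<integral>\<omega>. indicator ({\<omega> \<in> space P. norm (R \<omega>) > t} - {\<omega> \<in> space P. norm (R \<omega>) > 2 * t}) \<omega> \<partial>P)"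
      by simp
    also have "\<dots> \<le> (\<integral>\<omega>. annulus_bump (a n *v R \<omega>) \<partial>P)"
    proof (rule integral_mono)
      show "integrable P (\<lambda>\<omega>. annulus_bump (a n *v R \<omega>))"
        by (rule integrable_const_bound[where B = 1]) (simp_all add: bm annulus_bump_bounds abs_of_nonneg)
      show "indicator ({\<omega> \<in> space P. norm (R \<omega>) > t} - {\<omega> \<in> space P. norm (R \<omega>) > 2 * t}) \<omega> \<le> annulus_bump (a n *v R \<omega>)" for \<omega>
      proof (cases "norm (R \<omega>) > t \<and> norm (R \<omega>) \<le> 2 * t")
        case True
        then have "annulus_bump (a n *v R \<omega>) = 1"
          using q by (intro annulus_bump_ge) (auto simp: a(2) t_def field_simps)
        then show ?thesis by (simp add: indicator_def)
      next
        case False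
        then show ?thesis using annulus_bump_bounds by (auto simp: indicator_def)
      qed
    next
      have "{\<omega> \<in> space P. norm (R \<omega>) > t} - {\<omega> \<in> space P. norm (R \<omega>) > 2 * t} \<in> sets P" by measurable
      then show "integrable P (indicat_real ({\<omega> \<in> space P. norm (R \<omega>) > t} - {\<omega> \<in> space P. norm (R \<omega>) > 2 * t}))"
        by (rule integrable_real_indicator) (simp add: less_top[symmetric])
    qed
    finally have "t powr \<beta> * (prob {\<omega> \<in> space P. norm (R \<omega>) > t} - prob {\<omega> \<in> space P. norm (R \<omega>) > 2 * t}) \<le>
      t powr \<beta> * (\<integral>\<omega>. annulus_bump (a n *v R \<omega>) \<partial>P)" by (intro mult_left_mono) auto
    moreover have T1: "T t = t powr \<beta> * prob {\<omega> \<in> space P. norm (R \<omega>) > t}" by (simp only: T_def)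
    moreover have T2: "2 powr (- \<beta>) * T (2 * t) = t powr \<beta> * prob {\<omega> \<in> space P. norm (R \<omega>) > 2 * t}"
      using t by (simp add: T_def powr_mult powr_minus field_simps)
    ultimately show ?thesis unfolding t_def[symmetric] t(2) by (simp only: T1 T2 right_diff_distrib)
  qed
  ultimately have "K - 2 powr (- \<beta>) * K \<le> (\<integral>x. annulus_bump x \<partial>\<Lambda>)"
    using lim1 by (intro LIMSEQ_le) auto
  moreover have "2 powr (- \<beta>) < 2 powr (0::real)" using \<beta> by (intro powr_less_mono) auto
  then have "0 < K * (1 - 2 powr (- \<beta>))" using Kpos by (intro mult_pos_pos) auto
  ultimately show ?thesis by (simp add: algebra_simps)
qed

lemma spherical_part_zero:
  assumes sp: "is_spherical_part \<beta> \<Lambda> \<sigma>" and z: "measure \<sigma> (sphere 0 1) = 0" and f: "f \<in> Cc_punctured"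
  shows "(\<integral>x. f x \<partial>\<Lambda>) = 0"
proof -
  have sets: "sets \<sigma> = sets (restrict_space borel (sphere 0 1))" and "finite_measure \<sigma>"
    using sp by (auto simp: is_spherical_part_def)
  interpret finite_measure \<sigma> by fact
  have "space \<sigma> = sphere 0 1" using sets_eq_imp_space_eq[OF sets] by (simp add: space_restrict_space)
  then have "emeasure \<sigma> (space \<sigma>) = 0" using z by (simp add: emeasure_eq_measure)
  then have "AE w in \<sigma>. P w" for P by (rule emeasure_0_AE)
  then have "(\<integral>w. f (t *\<^sub>R w) \<partial>\<sigma>) = 0" for t by (intro integral_eq_zero_AE) auto
  moreover have "(\<integral>x. f x \<partial>\<Lambda>) = (LINT t:{0<..}|lborel. (\<integral>w. f (t *\<^sub>R w) \<partial>\<sigma>) * t powr (- 1 - \<beta>))"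
    using sp f unfolding is_spherical_part_def by blast
  ultimately show ?thesis by (simp add: set_lebesgue_integral_def)
qed

section \<open>The dichotomy\<close>
theorem proposition2p12:
  fixes M :: "'a measure" and N :: nat
    and C :: "nat \<Rightarrow> 'a \<Rightarrow> real ^ 'n ^ 'n" and Q :: "'a \<Rightarrow> real ^ 'n"
    and P :: "'b measure" and R :: "'b \<Rightarrow> real ^ 'n"
    and \<mu> :: "(real ^ 'n ^ 'n) measure"
    and \<alpha> \<beta> K :: real
    and r :: "real ^ 'n" and S :: "real ^ 'n ^ 'n"
    and \<Lambda> \<sigma> :: "(real ^ 'n) measure"
  assumes "prob_space M" and "N \<ge> 2"
    and "\<And>i. i \<in> {1..N} \<Longrightarrow> C i \<in> borel_measurable M"
    and "\<And>i \<omega>. i \<in> {1..N} \<Longrightarrow> \<omega> \<in> space M \<Longrightarrow> C i \<omega> \<in> similarities"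
    and "Q \<in> borel_measurable M"
    and mu: "\<mu> = law_C M N C"
    and alpha: "ereal \<alpha> = alpha_exp N \<mu>" and beta: "ereal \<beta> = beta_exp N \<mu>"
    and "0 < \<alpha>" and "\<alpha> < \<beta>" and "ereal \<beta> < s_infty \<mu>"
    and "m_fun N \<mu> \<alpha> = 1" and "m_fun N \<mu> \<beta> = 1"
    and cases: "case_H M N C Q \<alpha> \<beta> r S P R \<or> case_I M N C Q \<alpha> \<beta> r P R"
    and "moment M (\<lambda>\<omega>. norm (Q \<omega>)) \<beta> < \<infinity>"
    and "\<And>i. i \<in> {1..N} \<Longrightarrow> nonarithmetic (distr M borel (\<lambda>\<omega>. ln (opnorm (C i \<omega>))))"
    and "finite_moment_ereal M (\<lambda>\<omega>. norm (Q \<omega>)) (s_infty \<mu>)"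
    and K: "((\<lambda>t. t powr \<beta> * measure P {\<omega> \<in> space P. norm (R \<omega>) > t}) \<longlongrightarrow> K) at_top"
    and Lambda: "is_tail_measure \<mu> \<beta> P R \<Lambda>"
    and sigma: "is_spherical_part \<beta> \<Lambda> \<sigma>"
  shows "(K > 0 \<and> measure \<sigma> (sphere 0 1) > 0) \<or>
         (\<forall>s. 0 < s \<and> ereal s < s_infty \<mu> \<longrightarrow> moment P (\<lambda>\<omega>. norm (R \<omega>)) s < \<infinity>)"
proof (cases "K > 0")
  case True
  interpret M: prob_space M by fact
  have N1: "N \<ge> 1" using \<open>N \<ge> 2\<close> by simp
  have sol: "is_solution M N C Q P R" using cases by (auto simp: case_H_def case_I_def)
  then have P: "prob_space P" and R: "R \<in> borel_measurable P" by (auto simp: is_solution_def)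
  have "nonarithmetic (distr M borel (\<lambda>\<omega>. ln (opnorm (C 1 \<omega>))))" using assms N1 by simp
  from exists_generator_off_unit_norm[where C = C and N = N and M = M, OF \<open>prob_space M\<close> N1 assms(3,4) this]
  obtain g where g: "g \<in> msupport \<mu> \<inter> similarities" "0 < opnorm g" "opnorm g \<noteq> 1"
    unfolding mu by blast
  have "0 < (\<integral>x. annulus_bump x \<partial>\<Lambda>)"
    using tail_measure_nonzero[OF P R _ True K Lambda g] \<open>0 < \<alpha>\<close> \<open>\<alpha> < \<beta>\<close> by simp
  then have "measure \<sigma> (sphere 0 1) \<noteq> 0"
    using spherical_part_zero[OF sigma _ annulus_bump_Cc] by force
  then have "measure \<sigma> (sphere 0 1) > 0" using measure_nonneg[of \<sigma> "sphere 0 1"] by linarith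
  with True show ?thesis by blast
next
  case False
  have N1: "N \<ge> 1" using \<open>N \<ge> 2\<close> by simp
  have sol: "is_solution M N C Q P R"
    and mom: "\<And>s. 0 < s \<Longrightarrow> s < \<beta> \<Longrightarrow> moment P (\<lambda>\<omega>. norm (R \<omega>)) s < \<infinity>"
    using cases by (auto simp: case_H_def case_I_def)
  interpret smoothing_fixed_point M N C Q P R
    using assms sol by (intro smoothing_fixed_point.intro smoothing_fixed_point_axioms.intro) auto
  have prob_\<mu>: "prob_space \<mu>" unfolding mu by (rule prob_space_law_C[OF assms(1) N1 C_meas])
  have sets_\<mu>: "sets \<mu> = sets borel" by (simp add: mu law_C_def)
  have "0 \<le> K"
    by (rule tendsto_lowerbound[OF K]) (auto intro: always_eventually)
  then have K0: "K = 0" using False by simp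
  have m_eq: "m_fun N \<mu> s = (\<Sum>i=1..N. \<integral>\<^sup>+\<omega>. ennreal (opnorm (C i \<omega>) powr s) \<partial>M)" for s
    unfolding mu by (rule m_fun_law_C[OF assms(1) N1 C_meas])
  have c: "integrable M (\<lambda>\<omega>. opnorm (C i \<omega>) powr s)" if "i \<in> {1..N}" "0 < s" "ereal s < s_infty \<mu>" for i s
  proof -
    have "m_fun N \<mu> s < \<infinity>"
      using finite_moment_below_s_infty[OF prob_\<mu> sets_\<mu> that(2,3)] by (simp add: m_fun_def ennreal_mult_less_top of_nat_less_top)
    then have "(\<integral>\<^sup>+\<omega>. ennreal (opnorm (C i \<omega>) powr s) \<partial>M) < \<infinity>"
      unfolding m_eq using that(1) by (simp add: less_top[symmetric])
    then show ?thesis using opnorm_C_meas[OF that(1)] by (intro integrableI_nonneg) auto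
  qed
  have total: "m_fun N \<mu> s = ennreal (total_moment s)" if "0 < s" "ereal s < s_infty \<mu>" for s
    unfolding m_eq total_moment_def using c that
    by (simp add: nn_integral_eq_integral sum_ennreal)
  have nz: "total_moment s \<noteq> 1" if s: "\<beta> < s" "ereal s < s_infty \<mu>" for s
  proof
    assume "total_moment s = 1"
    have "0 < s" using s \<open>0 < \<alpha>\<close> \<open>\<alpha> < \<beta>\<close> by linarith
    with \<open>total_moment s = 1\<close> s have "m_fun N \<mu> s \<le> 1" by (simp add: total)
    then have "ereal s \<le> beta_exp N \<mu>"
      unfolding beta_exp_def using s \<open>0 < s\<close> by (intro Sup_upper) auto
    then show False using s beta[symmetric] by simp
  qed
  show ?thesis
  proof (intro disjI2 allI impI)
    fix s assume s: "0 < s \<and> ereal s < s_infty \<mu>"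
    have "integrable P (\<lambda>\<omega>. norm (R \<omega>) powr s)"
    proof (rule all_moments_finite[of \<beta> "s_infty \<mu>"])
      show "integrable P (\<lambda>\<omega>. norm (R \<omega>) powr p)" if "0 < p" "p < \<beta>" for p
        using mom[OF that] by (simp add: integrable_iff_moment)
      show "integrable M (\<lambda>\<omega>. norm (Q \<omega>) powr p)" if "0 < p" "ereal p < s_infty \<mu>" for p
        by (rule finite_moment_below_ereal[OF assms(1) _ _ _ that]) (use assms in auto)
      show "((\<lambda>t. t powr \<beta> * measure P {\<omega> \<in> space P. norm (R \<omega>) > t}) \<longlongrightarrow> 0) at_top"
        using K K0 by simp
    qed (use s assms c nz in auto)
    then show "moment P (\<lambda>\<omega>. norm (R \<omega>)) s < \<infinity>" by (simp add: integrable_iff_moment)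
  qed
qed

end
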